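(* For any $\omega>0$, any $\alpha>0$ and any $h\in\left(-\frac{(1+4\alpha)^2}{8\omega^2},-\frac{1}{8\omega^2}\right)$, the isosceles three-body problem with Hamiltonian $$H(r,\theta,z,p_r,p_\theta,p_z)=\frac12\left(p_r^2+\frac{p_\theta^2}{r^2}+p_z^2\right)-\frac{1}{2r}-\frac{2\alpha}{\sqrt{r^2+\frac{\alpha+2}{\alpha}z^2}}$$ admits a non-planar (quasi-)periodic solution with energy $h$ and angular momentum $\omega$.
   Context: Here $(r,\theta,z)$ with $r>0$ are cylindrical coordinates and $(p_r,p_\theta,p_z)$ their conjugate momenta. The angular momentum is the conserved quantity $p_\theta$, and the energy is the value of $H$. Fixing $p_\theta=\omega$, the system reduces to the system in $(r,z)$ with Hamiltonian $\frac12(p_r^2+p_z^2)+V(r,z)$, where $V(r,z)=\frac{\omega^2}{2r^2}-\frac{1}{2r}-\frac{2\alpha}{\sqrt{r^2+\frac{\alpha+2}{\alpha}z^2}}$. A (quasi-)periodic solution means a solution whose $(r,z)$-component is a periodic solution of this reduced system, with some period $T$; with $\Delta\theta=\int_0^T\omega/r(t)^2\,dt$, the solution of the full system is periodic if $\Delta\theta/(2\pi)$ is rational and quasi-periodic if it is irrational. A solution is planar if $z\equiv0$, and non-planar otherwise. *)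

theory Defs
  imports "HOL-Analysis.Analysis"
begin

definition isosceles_H ::
    "real \<Rightarrow> real \<Rightarrow> real \<Rightarrow> real \<Rightarrow> real \<Rightarrow> real \<Rightarrow> real \<Rightarrow> real" where
  "isosceles_H \<alpha> r \<theta> z p\<^sub>r p\<^sub>\<theta> p\<^sub>z =
     1/2 * (p\<^sub>r^2 + p\<^sub>\<theta>^2 / r^2 + p\<^sub>z^2) - 1 / (2 * r)
       - 2 * \<alpha> / sqrt (r^2 + (\<alpha> + 2) / \<alpha> * z^2)"

text \<open>
  Hamilton's equations. The angle \<open>\<theta>\<close> is represented by a lift to the real line. Since \<open>r > 0\<close>
  and (for \<open>\<alpha> > 0\<close>) the Hamiltonian is smooth there, every \<^const>\<open>deriv\<close> below is a genuine
  partial derivative.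
\<close>

definition isosceles_solution ::
    "real \<Rightarrow> (real \<Rightarrow> real) \<Rightarrow> (real \<Rightarrow> real) \<Rightarrow> (real \<Rightarrow> real) \<Rightarrow>
     (real \<Rightarrow> real) \<Rightarrow> (real \<Rightarrow> real) \<Rightarrow> (real \<Rightarrow> real) \<Rightarrow> bool" where
  "isosceles_solution \<alpha> r \<theta> z p\<^sub>r p\<^sub>\<theta> p\<^sub>z \<longleftrightarrow>
     (\<forall>t. r t > 0 \<and>
       (r has_real_derivative
          deriv (\<lambda>x. isosceles_H \<alpha> (r t) (\<theta> t) (z t) x (p\<^sub>\<theta> t) (p\<^sub>z t)) (p\<^sub>r t)) (at t) \<and>
       (\<theta> has_real_derivative
          deriv (\<lambda>x. isosceles_H \<alpha> (r t) (\<theta> t) (z t) (p\<^sub>r t) x (p\<^sub>z t)) (p\<^sub>\<theta> t)) (at t) \<and>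
       (z has_real_derivative
          deriv (\<lambda>x. isosceles_H \<alpha> (r t) (\<theta> t) (z t) (p\<^sub>r t) (p\<^sub>\<theta> t) x) (p\<^sub>z t)) (at t) \<and>
       (p\<^sub>r has_real_derivative
          - deriv (\<lambda>x. isosceles_H \<alpha> x (\<theta> t) (z t) (p\<^sub>r t) (p\<^sub>\<theta> t) (p\<^sub>z t)) (r t)) (at t) \<and>
       (p\<^sub>\<theta> has_real_derivative
          - deriv (\<lambda>x. isosceles_H \<alpha> (r t) x (z t) (p\<^sub>r t) (p\<^sub>\<theta> t) (p\<^sub>z t)) (\<theta> t)) (at t) \<and>
       (p\<^sub>z has_real_derivative
          - deriv (\<lambda>x. isosceles_H \<alpha> (r t) (\<theta> t) x (p\<^sub>r t) (p\<^sub>\<theta> t) (p\<^sub>z t)) (z t)) (at t))"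

definition reduced_V :: "real \<Rightarrow> real \<Rightarrow> real \<Rightarrow> real \<Rightarrow> real" where
  "reduced_V \<alpha> \<omega> r z =
     \<omega>^2 / (2 * r^2) - 1 / (2 * r) - 2 * \<alpha> / sqrt (r^2 + (\<alpha> + 2) / \<alpha> * z^2)"

definition reduced_H :: "real \<Rightarrow> real \<Rightarrow> real \<Rightarrow> real \<Rightarrow> real \<Rightarrow> real \<Rightarrow> real" where
  "reduced_H \<alpha> \<omega> r z p\<^sub>r p\<^sub>z = 1/2 * (p\<^sub>r^2 + p\<^sub>z^2) + reduced_V \<alpha> \<omega> r z"

definition reduced_solution ::
    "real \<Rightarrow> real \<Rightarrow> (real \<Rightarrow> real) \<Rightarrow> (real \<Rightarrow> real) \<Rightarrow>
     (real \<Rightarrow> real) \<Rightarrow> (real \<Rightarrow> real) \<Rightarrow> bool" where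
  "reduced_solution \<alpha> \<omega> r z p\<^sub>r p\<^sub>z \<longleftrightarrow>
     (\<forall>t. r t > 0 \<and>
       (r has_real_derivative deriv (\<lambda>x. reduced_H \<alpha> \<omega> (r t) (z t) x (p\<^sub>z t)) (p\<^sub>r t)) (at t) \<and>
       (z has_real_derivative deriv (\<lambda>x. reduced_H \<alpha> \<omega> (r t) (z t) (p\<^sub>r t) x) (p\<^sub>z t)) (at t) \<and>
       (p\<^sub>r has_real_derivative - deriv (\<lambda>x. reduced_H \<alpha> \<omega> x (z t) (p\<^sub>r t) (p\<^sub>z t)) (r t)) (at t) \<and>
       (p\<^sub>z has_real_derivative - deriv (\<lambda>x. reduced_H \<alpha> \<omega> (r t) x (p\<^sub>r t) (p\<^sub>z t)) (z t)) (at t))"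

text \<open>\<open>T\<close> is some positive period, not necessarily the minimal one.\<close>

definition reduced_periodic_solution ::
    "real \<Rightarrow> real \<Rightarrow> real \<Rightarrow> (real \<Rightarrow> real) \<Rightarrow> (real \<Rightarrow> real) \<Rightarrow>
     (real \<Rightarrow> real) \<Rightarrow> (real \<Rightarrow> real) \<Rightarrow> bool" where
  "reduced_periodic_solution \<alpha> \<omega> T r z p\<^sub>r p\<^sub>z \<longleftrightarrow>
     reduced_solution \<alpha> \<omega> r z p\<^sub>r p\<^sub>z \<and> T > 0 \<and>
     (\<forall>t. r (t + T) = r t \<and> z (t + T) = z t \<and> p\<^sub>r (t + T) = p\<^sub>r t \<and> p\<^sub>z (t + T) = p\<^sub>z t)"

definition has_angular_momentum :: "real \<Rightarrow> (real \<Rightarrow> real) \<Rightarrow> bool" where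
  "has_angular_momentum \<omega> p\<^sub>\<theta> \<longleftrightarrow> (\<forall>t. p\<^sub>\<theta> t = \<omega>)"

definition has_energy ::
    "real \<Rightarrow> real \<Rightarrow> (real \<Rightarrow> real) \<Rightarrow> (real \<Rightarrow> real) \<Rightarrow> (real \<Rightarrow> real) \<Rightarrow>
     (real \<Rightarrow> real) \<Rightarrow> (real \<Rightarrow> real) \<Rightarrow> (real \<Rightarrow> real) \<Rightarrow> bool" where
  "has_energy \<alpha> h r \<theta> z p\<^sub>r p\<^sub>\<theta> p\<^sub>z \<longleftrightarrow>
     (\<forall>t. isosceles_H \<alpha> (r t) (\<theta> t) (z t) (p\<^sub>r t) (p\<^sub>\<theta> t) (p\<^sub>z t) = h)"

definition planar :: "(real \<Rightarrow> real) \<Rightarrow> bool" where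
  "planar z \<longleftrightarrow> (\<forall>t. z t = 0)"

definition delta_theta :: "real \<Rightarrow> real \<Rightarrow> (real \<Rightarrow> real) \<Rightarrow> real" where
  "delta_theta \<omega> T r = integral {0..T} (\<lambda>t. \<omega> / (r t)^2)"

text \<open>
  The rotation number \<^term>\<open>delta_theta \<omega> T r / (2 * pi)\<close> decides between the two cases of a
  (quasi-)periodic solution, with angular momentum \<open>\<omega>\<close>, of the full system.
\<close>

definition periodic_solution ::
    "real \<Rightarrow> real \<Rightarrow> (real \<Rightarrow> real) \<Rightarrow> (real \<Rightarrow> real) \<Rightarrow> (real \<Rightarrow> real) \<Rightarrow>
     (real \<Rightarrow> real) \<Rightarrow> (real \<Rightarrow> real) \<Rightarrow> (real \<Rightarrow> real) \<Rightarrow> bool" where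
  "periodic_solution \<alpha> \<omega> r \<theta> z p\<^sub>r p\<^sub>\<theta> p\<^sub>z \<longleftrightarrow>
     isosceles_solution \<alpha> r \<theta> z p\<^sub>r p\<^sub>\<theta> p\<^sub>z \<and> has_angular_momentum \<omega> p\<^sub>\<theta> \<and>
     (\<exists>T. reduced_periodic_solution \<alpha> \<omega> T r z p\<^sub>r p\<^sub>z \<and> delta_theta \<omega> T r / (2 * pi) \<in> \<rat>)"

definition quasi_periodic_solution ::
    "real \<Rightarrow> real \<Rightarrow> (real \<Rightarrow> real) \<Rightarrow> (real \<Rightarrow> real) \<Rightarrow> (real \<Rightarrow> real) \<Rightarrow>
     (real \<Rightarrow> real) \<Rightarrow> (real \<Rightarrow> real) \<Rightarrow> (real \<Rightarrow> real) \<Rightarrow> bool" where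
  "quasi_periodic_solution \<alpha> \<omega> r \<theta> z p\<^sub>r p\<^sub>\<theta> p\<^sub>z \<longleftrightarrow>
     isosceles_solution \<alpha> r \<theta> z p\<^sub>r p\<^sub>\<theta> p\<^sub>z \<and> has_angular_momentum \<omega> p\<^sub>\<theta> \<and>
     (\<exists>T. reduced_periodic_solution \<alpha> \<omega> T r z p\<^sub>r p\<^sub>z \<and> delta_theta \<omega> T r / (2 * pi) \<notin> \<rat>)"

lemma periodic_or_quasi_periodic_iff:
  "periodic_solution \<alpha> \<omega> r \<theta> z p\<^sub>r p\<^sub>\<theta> p\<^sub>z \<or> quasi_periodic_solution \<alpha> \<omega> r \<theta> z p\<^sub>r p\<^sub>\<theta> p\<^sub>z \<longleftrightarrow>
     isosceles_solution \<alpha> r \<theta> z p\<^sub>r p\<^sub>\<theta> p\<^sub>z \<and> has_angular_momentum \<omega> p\<^sub>\<theta> \<and>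
     (\<exists>T. reduced_periodic_solution \<alpha> \<omega> T r z p\<^sub>r p\<^sub>z)"
  unfolding periodic_solution_def quasi_periodic_solution_def by blast

end

theory Submission
  imports Defs
begin

text \<open>
  Write \<open>V\<close> for the reduced potential. Below the energy \<open>- 1 / (8 * \<omega>^2)\<close> the Hill region
  \<open>V \<le> h\<close> is compact, and \<open>\<partial>V/\<partial>z\<close> has the sign of \<open>z\<close>, so the motion keeps being pulled back to
  the plane \<open>z = 0\<close>. The periodic solution is found by shooting. Release the system at rest from the
  point of the zero velocity curve \<open>V = h\<close>, \<open>z > 0\<close>, with first coordinate \<open>s\<close>. By Sturm comparison
  with a harmonic oscillator, \<open>z\<close> decreases to \<open>0\<close> within a time bound independent of \<open>s\<close>
  (\<open>crossing_exists\<close>), and the crossing is transversal, so the radial momentum \<open>P(s)\<close> at the crossing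
  depends continuously on \<open>s\<close> (\<open>crossing_momentum_continuous\<close>). If \<open>P(s) = 0\<close>, the orbit meets
  \<open>z = 0\<close> perpendicularly; reflecting it there, and reversing time at the point of rest, shows that
  it has period four times the crossing time (\<open>symmetric_solution_periodic\<close>).

  It remains to see that \<open>P\<close> changes sign. As \<open>s\<close> tends to one of the ends \<open>r_min\<close>, \<open>r_max\<close> of the
  zero velocity curve, the orbit approaches the planar Kepler orbit \<open>R(t)\<close> of energy \<open>h\<close> started at
  the pericentre or the apocentre. The variation of \<open>z\<close> along it satisfies
  \<open>z'' = - 2 * (\<alpha> + 2) / R^3 * z\<close>, whereas \<open>y = R - l\<close>, with \<open>l\<close> the semi-latus rectum, satisfies
  \<open>y'' = - k / R^3 * y\<close> with \<open>k = 2 * \<alpha> + 1 / 2\<close>. Since \<open>k < 2 * (\<alpha> + 2)\<close> and both start at rest,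
  \<open>z\<close> vanishes before \<open>y\<close> does (\<open>crossing_before_semi_latus_rectum\<close>). Until then the radial motion
  has not turned round, so \<open>P > 0\<close> near the pericentre and \<open>P < 0\<close> near the apocentre
  (\<open>crossing_momentum_sign_near_turning_point\<close>), and the intermediate value theorem applies.

  Existence of global solutions and their continuous dependence on the initial state are proved for
  globally Lipschitz vector fields. The reduced field is singular at \<open>r = 0\<close>, but on the level \<open>h\<close> it
  coincides with the Lipschitz field in which \<open>r\<close> is replaced by \<open>max (r_min / 2) r\<close>.
\<close>

section \<open>Ordinary differential equations with a Lipschitz right-hand side\<close>

text \<open>
  Indefinite integration from \<open>0\<close> in both time directions. For an interval with reversed bounds the
  integral over \<open>{a..b}\<close> vanishes, so the difference of two such integrals is the oriented integral.
\<close>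

lemma antiderivative_on_line:
  fixes g :: "real \<Rightarrow> 'a::banach"
  assumes cont: "continuous_on UNIV g"
  obtains G where "G 0 = 0" "\<And>t. (G has_vector_derivative g t) (at t)"
proof -
  define G where "G t = integral {0..t} g - integral {t..0} g" for t
  have int: "g integrable_on {a..b}" for a b
    by (meson cont continuous_on_subset integrable_continuous_real subset_UNIV)
  have eq: "G u = integral {a..u} g - integral {a..0} g" if "a \<le> u" "a \<le> 0" for a u
  proof (cases "u \<ge> 0")
    case True
    have "integral {a..0} g + integral {0..u} g = integral {a..u} g"
      by (rule Henstock_Kurzweil_Integration.integral_combine[OF that(2) True int])
    moreover have "integral {u..0} g = 0"
      using True by (cases "u = 0") auto
    ultimately show ?thesis by (simp add: G_def algebra_simps)
  next
    case False
    have "integral {a..u} g + integral {u..0} g = integral {a..0} g"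
      by (rule Henstock_Kurzweil_Integration.integral_combine[OF that(1) _ int]) (use False in simp)
    moreover have "integral {0..u} g = 0"
      using False by auto
    ultimately show ?thesis by (simp add: G_def algebra_simps)
  qed
  have "(G has_vector_derivative g t) (at t)" for t
  proof -
    define a b where "a = - \<bar>t\<bar> - 1" and "b = \<bar>t\<bar> + 1"
    have t: "t \<in> {a<..<b}" "a \<le> 0" by (auto simp: a_def b_def)
    have "((\<lambda>u. integral {a..u} g) has_vector_derivative g t) (at t within {a..b})"
      by (rule integral_has_vector_derivative) (use t cont in \<open>auto intro: continuous_on_subset\<close>)
    then have "((\<lambda>u. integral {a..u} g) has_vector_derivative g t) (at t)"
      using at_within_Icc_at[of a t b] t by simp
    then have "((\<lambda>u. integral {a..u} g - integral {a..0} g) has_vector_derivative g t) (at t)"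
      by (auto intro!: derivative_eq_intros)
    then show ?thesis
      by (rule has_vector_derivative_transform_within_open[of _ _ _ "{a<..<b}"])
         (use t in \<open>auto simp: eq[of a]\<close>)
  qed
  moreover have "G 0 = 0" by (simp add: G_def)
  ultimately show ?thesis using that by blast
qed

lemma has_vector_derivative_time_reversal:
  assumes "(x has_vector_derivative v) (at (- t))"
  shows "((\<lambda>t. x (- t)) has_vector_derivative - v) (at t)"
proof -
  have "(uminus has_vector_derivative - 1) (at (t::real))"
    by (auto simp flip: has_real_derivative_iff_has_vector_derivative intro!: derivative_eq_intros)
  from vector_diff_chain_at[OF this assms] show ?thesis by (simp add: o_def)
qed

text \<open>
  The weight \<open>exp (K * \<bar>t\<bar>)\<close> reproduces itself under integration up to the factor \<open>1 / K\<close>. Picking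
  \<open>K\<close> larger than a Lipschitz constant therefore turns the Picard operator into a contraction on the
  whole time axis.
\<close>

lemma exp_growth_bound:
  fixes D :: "real \<Rightarrow> 'a::real_normed_vector"
  assumes D: "\<And>t. (D has_vector_derivative D' t) (at t)" "D 0 = 0"
    and bd: "\<And>t. norm (D' t) \<le> M * exp (K * \<bar>t\<bar>)" and K: "K > 0" and M: "M \<ge> 0"
  shows "norm (D t) \<le> M / K * exp (K * \<bar>t\<bar>)"
proof -
  have pos: "norm (D t) \<le> M / K * exp (K * t)"
    if D: "\<And>t. (D has_vector_derivative D' t) (at t)" "D 0 = 0"
      and bd: "\<And>t. norm (D' t) \<le> M * exp (K * \<bar>t\<bar>)" and t: "t > 0"
    for D D' :: "real \<Rightarrow> 'a" and t
  proof -
    have "norm (D t - D 0) \<le> M / K * exp (K * t) - M / K * exp (K * 0)"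
    proof (rule differentiable_bound_general[OF t])
      show "continuous_on {0..t} D"
        using D(1) by (meson continuous_at_imp_continuous_on has_vector_derivative_continuous)
      show "continuous_on {0..t} (\<lambda>t. M / K * exp (K * t))"
        by (intro continuous_intros)
      show "(D has_vector_derivative D' x) (at x)" for x by (rule D)
      show "((\<lambda>t. M / K * exp (K * t)) has_vector_derivative M * exp (K * x)) (at x)" for x
        unfolding has_real_derivative_iff_has_vector_derivative[symmetric]
        using K by (auto intro!: derivative_eq_intros)
      show "norm (D' x) \<le> M * exp (K * x)" if "0 < x" for x
        using bd[of x] that by simp
    qed
    moreover have "M / K \<ge> 0" using K M by simp
    ultimately show ?thesis using D(2) by simp
  qed
  consider "t > 0" | "t = 0" | "t < 0" by linarith
  then show ?thesis
  proof cases
    case 1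
    then show ?thesis using pos[OF D bd] by simp
  next
    case 2
    then show ?thesis using D K M by simp
  next
    case 3
    have "((\<lambda>t. D (- t)) has_vector_derivative - D' (- t)) (at t)" for t
      by (intro has_vector_derivative_time_reversal D)
    moreover have "norm (- D' (- s)) \<le> M * exp (K * \<bar>s\<bar>)" for s
      using bd[of "- s"] by simp
    ultimately show ?thesis
      using pos[of "\<lambda>t. D (- t)" "\<lambda>t. - D' (- t)" "- t"] 3 D(2) by auto
  qed
qed

text \<open>
  Solutions on all of \<open>\<real>\<close> come from a single application of the Banach fixed point theorem,
  without gluing local solutions: the unknown is \<open>y t = exp (- (K * \<bar>t\<bar>)) *\<^sub>R x t\<close>, which lies in
  the Banach space of bounded continuous functions because Lipschitz fields grow at most linearly.
\<close>

lemma lipschitz_ode_global_solution: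
  fixes f :: "'a::banach \<Rightarrow> 'a"
  assumes lip: "L-lipschitz_on UNIV f"
  obtains x where "x 0 = x0" "\<And>t. (x has_vector_derivative f (x t)) (at t)"
proof -
  define K where "K = L + 1"
  have L: "L \<ge> 0" using lip lipschitz_on_nonneg by blast
  have K: "K > 0" using L by (simp add: K_def)
  have fcont: "continuous_on UNIV f" using lip by (rule lipschitz_on_continuous_on)
  \<comment> \<open>\<open>Y y\<close> is the curve encoded by \<open>y\<close>; \<open>F y\<close> encodes the Picard iterate of that curve.\<close>
  define Y :: "(real \<Rightarrow>\<^sub>C 'a) \<Rightarrow> real \<Rightarrow> 'a" where "Y y t = exp (K * \<bar>t\<bar>) *\<^sub>R apply_bcontfun y t" for y t
  have Ycont: "continuous_on UNIV (\<lambda>t. f (Y y t))" for y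
    unfolding Y_def
    by (intro continuous_on_compose2[OF fcont] continuous_intros) auto
  have "\<exists>G. G 0 = 0 \<and> (\<forall>t. (G has_vector_derivative f (Y y t)) (at t))" for y
    using antiderivative_on_line[OF Ycont] by metis
  then obtain G where G: "\<And>y. G y 0 = 0" "\<And>y t. (G y has_vector_derivative f (Y y t)) (at t)"
    by metis
  define F where "F y t = exp (- (K * \<bar>t\<bar>)) *\<^sub>R (x0 + G y t)" for y t
  have FE: "exp (K * \<bar>t\<bar>) *\<^sub>R F y t = x0 + G y t" for y t
    by (simp add: F_def exp_minus)
  have nY: "norm (f (Y y t)) \<le> (norm (f 0) + L * norm y) * exp (K * \<bar>t\<bar>)" for y t
  proof -
    have "norm (f (Y y t)) \<le> norm (f 0) + dist (f (Y y t)) (f 0)"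
      by (metis add.commute dist_norm norm_triangle_sub)
    also have "dist (f (Y y t)) (f 0) \<le> L * dist (Y y t) 0"
      using lip by (rule lipschitz_onD) auto
    also have "L * dist (Y y t) 0 \<le> L * (exp (K * \<bar>t\<bar>) * norm y)"
      using L by (intro mult_left_mono) (simp_all add: Y_def norm_bounded)
    also have "norm (f 0) + L * (exp (K * \<bar>t\<bar>) * norm y)
        \<le> norm (f 0) * exp (K * \<bar>t\<bar>) + L * (exp (K * \<bar>t\<bar>) * norm y)"
      using K by (simp add: mult_le_cancel_left1)
    finally show ?thesis using L by (simp add: algebra_simps)
  qed
  have nG: "norm (G y t) \<le> (norm (f 0) + L * norm y) / K * exp (K * \<bar>t\<bar>)" for y t
    by (rule exp_growth_bound[OF G(2,1) nY K]) (use L in auto)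
  have Fb: "F y \<in> bcontfun" for y
  proof (rule bcontfun_normI)
    have "continuous_on UNIV (G y)"
      using G(2) by (meson continuous_at_imp_continuous_on has_vector_derivative_continuous)
    then show "continuous_on UNIV (F y)"
      unfolding F_def by (intro continuous_intros)
    show "norm (F y t) \<le> norm x0 + (norm (f 0) + L * norm y) / K" for t
    proof -
      have "norm (x0 + G y t) \<le> norm x0 * exp (K * \<bar>t\<bar>) + (norm (f 0) + L * norm y) / K * exp (K * \<bar>t\<bar>)"
        using K by (intro norm_triangle_le add_mono nG) (auto simp: mult_le_cancel_left1)
      then have "exp (- (K * \<bar>t\<bar>)) * norm (x0 + G y t)
         \<le> exp (- (K * \<bar>t\<bar>)) * ((norm x0 + (norm (f 0) + L * norm y) / K) * exp (K * \<bar>t\<bar>))"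
        by (intro mult_left_mono) (auto simp: algebra_simps)
      also have "\<dots> = norm x0 + (norm (f 0) + L * norm y) / K"
        by (simp add: exp_minus)
      finally show ?thesis by (simp add: F_def)
    qed
  qed
  define T where "T y = Bcontfun (F y)" for y
  have T: "apply_bcontfun (T y) t = F y t" for y t
    using Fb by (simp add: T_def Bcontfun_inverse)
  have "\<exists>!y. T y = y"
  proof (rule banach_fix_type)
    show "0 \<le> L / K" "L / K < 1" using L K by (auto simp: K_def)
    show "\<forall>y z. dist (T y) (T z) \<le> L / K * dist y z"
    proof (intro allI dist_bound)
      fix y z t
      have "norm (G y t - G z t) \<le> (L * dist y z) / K * exp (K * \<bar>t\<bar>)"
      proof (rule exp_growth_bound[where D' = "\<lambda>t. f (Y y t) - f (Y z t)"])
        show "((\<lambda>t. G y t - G z t) has_vector_derivative f (Y y t) - f (Y z t)) (at t)" for t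
          by (intro derivative_intros G)
        show "norm (f (Y y t) - f (Y z t)) \<le> L * dist y z * exp (K * \<bar>t\<bar>)" for t
        proof -
          have "norm (f (Y y t) - f (Y z t)) \<le> L * dist (Y y t) (Y z t)"
            using lipschitz_onD[OF lip, of "Y y t" "Y z t"] by (simp add: dist_norm)
          also have "L * dist (Y y t) (Y z t) = L * (exp (K * \<bar>t\<bar>) * dist (apply_bcontfun y t) (apply_bcontfun z t))"
            by (simp add: Y_def dist_norm flip: scaleR_diff_right)
          also have "\<dots> \<le> L * (exp (K * \<bar>t\<bar>) * dist y z)"
            using L by (intro mult_left_mono) (simp_all add: dist_bounded)
          finally show ?thesis by (simp add: algebra_simps)
        qed
      qed (use G K L in auto)
      then have "exp (- (K * \<bar>t\<bar>)) * norm (G y t - G z t)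
          \<le> exp (- (K * \<bar>t\<bar>)) * ((L * dist y z) / K * exp (K * \<bar>t\<bar>))"
        by (intro mult_left_mono) auto
      also have "\<dots> = L / K * dist y z" by (simp add: exp_minus)
      finally show "dist (apply_bcontfun (T y) t) (apply_bcontfun (T z) t) \<le> L / K * dist y z"
        by (simp add: T F_def dist_norm flip: scaleR_diff_right)
    qed
  qed
  then obtain y where y: "T y = y" by blast
  have Yy: "Y y t = x0 + G y t" for t
    using FE[of t y] T[of y t] by (simp add: Y_def y)
  have "((\<lambda>t. x0 + G y t) has_vector_derivative f (Y y t)) (at t)" for t
    using G(2) by (auto intro!: derivative_eq_intros)
  then show ?thesis
    using that[of "Y y"] by (simp add: G(1) Yy[abs_def])
qed

text \<open>
  Gronwall's estimate: the derivative of the squared distance of two solutions is at most \<open>2 * L\<close>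
  times the squared distance. For negative times the same argument runs with the field \<open>- f\<close>.
\<close>

lemma lipschitz_ode_dependence:
  fixes f :: "'a::real_inner \<Rightarrow> 'a"
  assumes lip: "L-lipschitz_on UNIV f"
    and x: "\<And>t. (x has_vector_derivative f (x t)) (at t)"
    and y: "\<And>t. (y has_vector_derivative f (y t)) (at t)"
  shows "dist (x t) (y t) \<le> exp (L * \<bar>t\<bar>) * dist (x 0) (y 0)"
proof -
  have pos: "dist (x t) (y t) \<le> exp (L * t) * dist (x 0) (y 0)"
    if lip: "L-lipschitz_on UNIV f"
    and x: "\<And>t. (x has_vector_derivative f (x t)) (at t)"
    and y: "\<And>t. (y has_vector_derivative f (y t)) (at t)" and t: "t \<ge> 0"
    for f :: "'a \<Rightarrow> 'a" and x y t
  proof -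
    define u where "u t = (x t - y t) \<bullet> (x t - y t)" for t
    define v where "v t = exp (- (2 * L * t)) * u t" for t
    have du: "(u has_real_derivative 2 * ((x t - y t) \<bullet> (f (x t) - f (y t)))) (at t)" for t
    proof -
      have "((\<lambda>t. x t - y t) has_vector_derivative (f (x t) - f (y t))) (at t)"
        by (intro derivative_intros x y)
      from bounded_bilinear.has_vector_derivative[OF bounded_bilinear_inner this this]
      show ?thesis
        unfolding u_def has_real_derivative_iff_has_vector_derivative
        by (simp add: inner_commute)
    qed
    have dv: "(v has_real_derivative
        exp (- (2 * L * t)) * (2 * ((x t - y t) \<bullet> (f (x t) - f (y t))) - 2 * L * u t)) (at t)" for t
      unfolding v_def by (auto intro!: derivative_eq_intros du simp: algebra_simps)
    have le: "exp (- (2 * L * t)) * (2 * ((x t - y t) \<bullet> (f (x t) - f (y t))) - 2 * L * u t) \<le> 0" for t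
    proof -
      have "(x t - y t) \<bullet> (f (x t) - f (y t)) \<le> norm (x t - y t) * norm (f (x t) - f (y t))"
        by (rule norm_cauchy_schwarz)
      also have "\<dots> \<le> norm (x t - y t) * (L * norm (x t - y t))"
        using lipschitz_onD[OF lip, of "x t" "y t"] by (simp add: dist_norm mult_left_mono)
      also have "\<dots> = L * u t"
        by (simp add: u_def dot_square_norm power2_eq_square)
      finally show ?thesis by (simp add: mult_nonneg_nonpos)
    qed
    have "v t \<le> v 0"
      by (rule DERIV_nonpos_imp_nonincreasing[OF t]) (use dv le in blast)
    then have "(dist (x t) (y t))^2 \<le> exp (2 * L * t) * (dist (x 0) (y 0))^2"
      by (simp add: v_def u_def dot_square_norm dist_norm exp_minus field_simps)
    also have "\<dots> = (exp (L * t) * dist (x 0) (y 0))^2"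
      using exp_double[of "L * t"] by (simp add: power_mult_distrib mult.assoc)
    finally show ?thesis
      by (rule power2_le_imp_le) simp
  qed
  show ?thesis
  proof (cases "t \<ge> 0")
    case True
    then show ?thesis using pos[OF lip x y] by simp
  next
    case False
    have rev: "((\<lambda>t. w (- t)) has_vector_derivative - f (w (- t))) (at t)"
      if "\<And>t. (w has_vector_derivative f (w t)) (at t)" for t w
      by (intro has_vector_derivative_time_reversal that)
    show ?thesis
      using pos[OF lipschitz_on_minus[OF lip] rev[OF x] rev[OF y], of "- t"] False by simp
  qed
qed

section \<open>The reduced Hamiltonian system\<close>

text \<open>
  The two accelerations \<open>- \<partial>V/\<partial>r\<close> and \<open>- \<partial>V/\<partial>z\<close> of the reduced system.
\<close>

definition acc_r :: "real \<Rightarrow> real \<Rightarrow> real \<Rightarrow> real \<Rightarrow> real" where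
  "acc_r \<alpha> \<omega> r z = \<omega>^2 / r^3 - 1 / (2 * r^2) - 2 * \<alpha> * r / sqrt (r^2 + (\<alpha> + 2) / \<alpha> * z^2) ^ 3"

definition acc_z :: "real \<Rightarrow> real \<Rightarrow> real \<Rightarrow> real" where
  "acc_z \<alpha> r z = - (2 * (\<alpha> + 2) * z / sqrt (r^2 + (\<alpha> + 2) / \<alpha> * z^2) ^ 3)"

lemma rho_ge:
  assumes "\<alpha> > 0" "r > 0"
  shows "r \<le> sqrt (r^2 + (\<alpha> + 2) / \<alpha> * z^2)"
  by (rule real_le_rsqrt) (use assms in simp)

lemma rho_pos:
  fixes \<alpha> r z :: real
  assumes "\<alpha> > 0" "r > 0"
  shows "r^2 + (\<alpha> + 2) / \<alpha> * z^2 > 0"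
  using assms by (intro add_pos_nonneg) auto

text \<open>
  The chain rule along a curve yields both partial derivatives of the potential, by taking curves
  parallel to the axes, and conservation of energy, by taking a solution.
\<close>

lemma reduced_V_along_curve:
  assumes "\<alpha> > 0" "r t > 0"
    and "(r has_real_derivative r') (at t)" "(z has_real_derivative z') (at t)"
  shows "((\<lambda>t. reduced_V \<alpha> \<omega> (r t) (z t)) has_real_derivative
           - (acc_r \<alpha> \<omega> (r t) (z t) * r' + acc_z \<alpha> (r t) (z t) * z')) (at t)"
proof -
  define \<beta> where "\<beta> = (\<alpha> + 2) / \<alpha>"
  define \<rho> where "\<rho> = sqrt ((r t)^2 + \<beta> * (z t)^2)"
  have \<rho>: "\<rho> > 0" "(r t)^2 + \<beta> * (z t)^2 > 0"
    using rho_pos[OF assms(1,2), of "z t"] by (simp_all add: \<rho>_def \<beta>_def)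
  have \<beta>: "2 * \<alpha> * \<beta> = 2 * (\<alpha> + 2)" using assms(1) by (simp add: \<beta>_def)
  have d: "((\<lambda>t. sqrt ((r t)^2 + \<beta> * (z t)^2)) has_real_derivative
      (r t * r' + \<beta> * z t * z') / \<rho>) (at t)"
    using \<rho> assms(3,4) unfolding \<rho>_def
    by (auto intro!: derivative_eq_intros simp: field_simps)
  have "((\<lambda>t. \<omega>^2 / (2 * (r t)^2)) has_real_derivative - (\<omega>^2 / (r t)^3) * r') (at t)"
    using assms(2,3) by (auto intro!: derivative_eq_intros) (simp add: field_simps power_numeral_reduce)
  moreover have "((\<lambda>t. 1 / (2 * r t)) has_real_derivative - (1 / (2 * (r t)^2) * r')) (at t)"
    using assms(2,3) by (auto intro!: derivative_eq_intros) (simp add: field_simps power_numeral_reduce)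
  moreover have "((\<lambda>t. 2 * \<alpha> / sqrt ((r t)^2 + \<beta> * (z t)^2)) has_real_derivative
      - (2 * \<alpha> * ((r t * r' + \<beta> * z t * z') / \<rho>) / \<rho>^2)) (at t)"
    by (rule DERIV_cong[OF DERIV_divide[OF DERIV_const d]]) (use \<rho> in \<open>auto simp: \<rho>_def power2_eq_square\<close>)
  ultimately have "((\<lambda>t. \<omega>^2 / (2 * (r t)^2) - 1 / (2 * r t) - 2 * \<alpha> / sqrt ((r t)^2 + \<beta> * (z t)^2)) has_real_derivative
      - (\<omega>^2 / (r t)^3) * r' - - (1 / (2 * (r t)^2) * r') - - (2 * \<alpha> * ((r t * r' + \<beta> * z t * z') / \<rho>) / \<rho>^2)) (at t)"
    by (intro DERIV_diff)
  moreover have "- (\<omega>^2 / (r t)^3) * r' - - (1 / (2 * (r t)^2) * r') - - (2 * \<alpha> * ((r t * r' + \<beta> * z t * z') / \<rho>) / \<rho>^2)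
      = - (acc_r \<alpha> \<omega> (r t) (z t) * r' + acc_z \<alpha> (r t) (z t) * z')"
  proof -
    have a: "acc_r \<alpha> \<omega> (r t) (z t) = \<omega>^2 / (r t)^3 - 1 / (2 * (r t)^2) - 2 * \<alpha> * r t / \<rho>^3"
      by (simp add: acc_r_def \<rho>_def \<beta>_def)
    have b: "acc_z \<alpha> (r t) (z t) = - (2 * \<alpha> * \<beta> * z t / \<rho>^3)"
      unfolding \<beta> by (simp add: acc_z_def \<rho>_def \<beta>_def)
    show ?thesis
      unfolding a b by (simp add: power2_eq_square power3_eq_cube add_divide_distrib algebra_simps)
  qed
  ultimately show ?thesis
    by (simp add: reduced_V_def \<beta>_def)
qed

lemma reduced_solution_iff:
  assumes "\<alpha> > 0"
  shows "reduced_solution \<alpha> \<omega> r z p q \<longleftrightarrow>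
    (\<forall>t. r t > 0 \<and> (r has_real_derivative p t) (at t) \<and> (z has_real_derivative q t) (at t) \<and>
       (p has_real_derivative acc_r \<alpha> \<omega> (r t) (z t)) (at t) \<and>
       (q has_real_derivative acc_z \<alpha> (r t) (z t)) (at t))"
proof -
  have 1: "deriv (\<lambda>x. reduced_H \<alpha> \<omega> r z x q) p = p" for r z p q
    unfolding reduced_H_def by (rule DERIV_imp_deriv) (auto intro!: derivative_eq_intros)
  have 2: "deriv (\<lambda>x. reduced_H \<alpha> \<omega> r z p x) q = q" for r z p q
    unfolding reduced_H_def by (rule DERIV_imp_deriv) (auto intro!: derivative_eq_intros)
  have 3: "deriv (\<lambda>x. reduced_H \<alpha> \<omega> x z p q) r = - acc_r \<alpha> \<omega> r z" if "r > 0" for r z p q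
    unfolding reduced_H_def
    by (rule DERIV_imp_deriv)
       (use reduced_V_along_curve[of \<alpha> "\<lambda>x. x" r 1 "\<lambda>_. z" 0 \<omega>] assms that
         in \<open>auto intro!: derivative_eq_intros\<close>)
  have 4: "deriv (\<lambda>x. reduced_H \<alpha> \<omega> r x p q) z = - acc_z \<alpha> r z" if "r > 0" for r z p q
    unfolding reduced_H_def
    by (rule DERIV_imp_deriv)
       (use reduced_V_along_curve[of \<alpha> "\<lambda>_. r" z 0 "\<lambda>x. x" 1 \<omega>] assms that
         in \<open>auto intro!: derivative_eq_intros\<close>)
  show ?thesis
    unfolding reduced_solution_def by (simp add: 1 2 3 4 cong: conj_cong)
qed

lemma isosceles_H_eq_reduced_H: "isosceles_H \<alpha> r \<theta> z p \<omega> q = reduced_H \<alpha> \<omega> r z p q"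
  by (simp add: isosceles_H_def reduced_H_def reduced_V_def algebra_simps add_divide_distrib)

text \<open>
  The angle is ignorable: it enters neither \<open>H\<close> nor the reduced equations, so it can be recovered
  afterwards by integrating \<open>\<omega> / r^2\<close>.
\<close>

lemma isosceles_solution_lift:
  assumes "reduced_solution \<alpha> \<omega> r z p q"
  obtains \<theta> where "isosceles_solution \<alpha> r \<theta> z p (\<lambda>_. \<omega>) q"
proof -
  have r: "r t > 0" and rd: "\<exists>D. (r has_real_derivative D) (at t)" for t
    using assms unfolding reduced_solution_def by blast+
  have "isCont r t" for t
    using rd DERIV_isCont by blast
  then have "continuous_on UNIV (\<lambda>t. \<omega> / (r t)^2)"
    by (auto intro!: continuous_intros continuous_at_imp_continuous_on simp: less_imp_neq[OF r, symmetric])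
  then obtain \<theta> where \<theta>: "\<And>t. (\<theta> has_real_derivative \<omega> / (r t)^2) (at t)"
    using antiderivative_on_line unfolding has_real_derivative_iff_has_vector_derivative by metis
  have "deriv (\<lambda>x. isosceles_H \<alpha> (r t) (\<theta> t) (z t) (p t) x (q t)) \<omega> = \<omega> / (r t)^2" for t
    unfolding isosceles_H_def using r[of t]
    by (intro DERIV_imp_deriv) (auto intro!: derivative_eq_intros simp: power_numeral_reduce)
  moreover have "deriv (\<lambda>x. isosceles_H \<alpha> (r t) x (z t) (p t) \<omega> (q t)) (\<theta> t) = 0" for t
    unfolding isosceles_H_def by (rule DERIV_imp_deriv) simp
  ultimately have "isosceles_solution \<alpha> r \<theta> z p (\<lambda>_. \<omega>) q"
    using assms \<theta> unfolding isosceles_solution_def reduced_solution_def isosceles_H_eq_reduced_H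
    by auto
  then show ?thesis by (rule that)
qed

lemma reduced_H_conserved:
  assumes "\<alpha> > 0" "reduced_solution \<alpha> \<omega> r z p q"
  shows "reduced_H \<alpha> \<omega> (r t) (z t) (p t) (q t) = reduced_H \<alpha> \<omega> (r 0) (z 0) (p 0) (q 0)"
proof -
  let ?E = "\<lambda>t. reduced_H \<alpha> \<omega> (r t) (z t) (p t) (q t)"
  have "(?E has_real_derivative 0) (at t)" for t
  proof -
    from assms have *: "r t > 0" "(r has_real_derivative p t) (at t)" "(z has_real_derivative q t) (at t)"
      "(p has_real_derivative acc_r \<alpha> \<omega> (r t) (z t)) (at t)"
      "(q has_real_derivative acc_z \<alpha> (r t) (z t)) (at t)"
      by (auto simp: reduced_solution_iff)
    show ?thesis
      unfolding reduced_H_def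
      using reduced_V_along_curve[where \<omega> = \<omega>, OF assms(1) *(1-3)] *(4,5)
      by (auto intro!: derivative_eq_intros simp: add_divide_distrib)
  qed
  then show ?thesis using DERIV_isconst_all[of ?E t 0] by blast
qed

text \<open>
  Products of Lipschitz functions need not be Lipschitz, but products of bounded ones are. The
  accelerations are polynomials in the bounded Lipschitz functions \<open>1 / r\<close>, \<open>1 / \<rho>\<close>, \<open>r / \<rho>\<close> and
  \<open>z / \<rho>\<close>, where \<open>\<rho> = sqrt (r^2 + (\<alpha> + 2) / \<alpha> * z^2)\<close>, as long as \<open>r\<close> stays away from \<open>0\<close>.
\<close>

definition bounded_lipschitz :: "('a::metric_space \<Rightarrow> real) \<Rightarrow> bool" where
  "bounded_lipschitz g \<longleftrightarrow> (\<exists>B. \<forall>x. \<bar>g x\<bar> \<le> B) \<and> (\<exists>L. L-lipschitz_on UNIV g)"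

lemma bounded_lipschitz_const: "bounded_lipschitz (\<lambda>_. c)"
  unfolding bounded_lipschitz_def using lipschitz_on_constant[of UNIV c] by blast

lemma bounded_lipschitz_diff:
  assumes "bounded_lipschitz g" "bounded_lipschitz k"
  shows "bounded_lipschitz (\<lambda>x. g x - k x)"
proof -
  from assms obtain B C where "\<And>x. \<bar>g x\<bar> \<le> B" "\<And>x. \<bar>k x\<bar> \<le> C"
    unfolding bounded_lipschitz_def by metis
  then have "\<bar>g x - k x\<bar> \<le> B + C" for x
    by (meson abs_triangle_ineq4 add_mono order_trans)
  with assms show ?thesis
    unfolding bounded_lipschitz_def by (blast intro: lipschitz_on_diff)
qed

lemma bounded_lipschitz_mult:
  assumes "bounded_lipschitz g" "bounded_lipschitz k"
  shows "bounded_lipschitz (\<lambda>x. g x * k x)"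
proof -
  from assms obtain B C L M where B: "\<And>x. \<bar>g x\<bar> \<le> B" and C: "\<And>x. \<bar>k x\<bar> \<le> C"
    and L: "L-lipschitz_on UNIV g" and M: "M-lipschitz_on UNIV k"
    unfolding bounded_lipschitz_def by metis
  have pos: "B \<ge> 0" "C \<ge> 0" "L \<ge> 0" "M \<ge> 0"
    using B C abs_ge_zero order_trans lipschitz_on_nonneg L M by blast+
  have "\<bar>g x * k x\<bar> \<le> B * C" for x
    unfolding abs_mult using B C pos by (intro mult_mono) auto
  moreover have "(B * M + L * C)-lipschitz_on UNIV (\<lambda>x. g x * k x)"
  proof (rule lipschitz_onI)
    fix x y
    have "\<bar>g x * k x - g y * k y\<bar> = \<bar>g x * (k x - k y) + (g x - g y) * k y\<bar>"
      by (simp add: algebra_simps)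
    also have "\<dots> \<le> \<bar>g x\<bar> * \<bar>k x - k y\<bar> + \<bar>g x - g y\<bar> * \<bar>k y\<bar>"
      by (metis abs_mult abs_triangle_ineq)
    also have "\<dots> \<le> B * (M * dist x y) + (L * dist x y) * C"
      using B C lipschitz_onD[OF L, of x y] lipschitz_onD[OF M, of x y] pos
      by (intro add_mono mult_mono) (auto simp: dist_real_def)
    finally show "dist (g x * k x) (g y * k y) \<le> (B * M + L * C) * dist x y"
      by (simp add: dist_real_def algebra_simps)
  qed (use pos in auto)
  ultimately show ?thesis
    unfolding bounded_lipschitz_def by blast
qed

lemma bounded_lipschitz_quotient:
  fixes u v :: "'a::metric_space \<Rightarrow> real"
  assumes L: "L-lipschitz_on UNIV v" and M: "M-lipschitz_on UNIV u"
    and c: "c > 0" "\<And>x. c \<le> u x" and v: "\<And>x. \<bar>v x\<bar> \<le> K * u x"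
  shows "bounded_lipschitz (\<lambda>x. v x / u x)"
proof -
  have u: "u x > 0" for x using c order_less_le_trans by blast
  have pos: "L \<ge> 0" "M \<ge> 0" using L M lipschitz_on_nonneg by blast+
  have K: "K \<ge> 0"
    using v[of undefined] u[of undefined] by (meson abs_ge_zero order_trans zero_le_mult_iff not_less)
  have b: "\<bar>v x / u x\<bar> \<le> K" for x
    using v u[of x] by (simp add: field_simps)
  moreover have "((L + K * M) / c)-lipschitz_on UNIV (\<lambda>x. v x / u x)"
  proof (rule lipschitz_onI)
    fix x y
    have "\<bar>v x / u x - v y / u y\<bar> = \<bar>(v x - v y) - (v y / u y) * (u x - u y)\<bar> / u x"
      using u[of x] u[of y] by (simp add: field_simps)
    also have "\<dots> \<le> (L * dist x y + K * (M * dist x y)) / u x"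
    proof (rule divide_right_mono)
      have "\<bar>(v y / u y) * (u x - u y)\<bar> \<le> K * (M * dist x y)"
        unfolding abs_mult using b lipschitz_onD[OF M, of x y] K
        by (intro mult_mono) (auto simp: dist_real_def)
      then show "\<bar>(v x - v y) - (v y / u y) * (u x - u y)\<bar> \<le> L * dist x y + K * (M * dist x y)"
        using lipschitz_onD[OF L UNIV_I UNIV_I, of x y] abs_triangle_ineq4[of "v x - v y" "(v y / u y) * (u x - u y)"]
        unfolding dist_real_def by linarith
    qed (use u less_imp_le in blast)
    also have "\<dots> \<le> (L * dist x y + K * (M * dist x y)) / c"
      using c pos K by (intro divide_left_mono mult_pos_pos u) auto
    finally show "dist (v x / u x) (v y / u y) \<le> (L + K * M) / c * dist x y"
      by (simp add: dist_real_def algebra_simps)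
  qed (use c pos K in auto)
  ultimately show ?thesis
    unfolding bounded_lipschitz_def by blast
qed

text \<open>
  The left-hand side is a difference of Euclidean norms of the vectors \<open>(a, sqrt \<beta> * b)\<close> and
  \<open>(c, sqrt \<beta> * d)\<close>.
\<close>

lemma rho_lipschitz:
  assumes "\<beta> \<ge> 0"
  shows "\<bar>sqrt (a^2 + \<beta> * b^2) - sqrt (c^2 + \<beta> * d^2)\<bar> \<le> \<bar>a - c\<bar> + sqrt \<beta> * \<bar>b - d\<bar>"
proof -
  have n: "sqrt (a^2 + \<beta> * b^2) = norm (a, sqrt \<beta> * b)" for a b
    using assms by (simp add: norm_Pair power_mult_distrib)
  have "\<bar>norm (a, sqrt \<beta> * b) - norm (c, sqrt \<beta> * d)\<bar> \<le> norm ((a, sqrt \<beta> * b) - (c, sqrt \<beta> * d))"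
    by (rule norm_triangle_ineq3)
  also have "\<dots> \<le> \<bar>a - c\<bar> + \<bar>sqrt \<beta> * b - sqrt \<beta> * d\<bar>"
    by (simp add: norm_Pair sqrt_sum_squares_le_sum_abs)
  also have "\<bar>sqrt \<beta> * b - sqrt \<beta> * d\<bar> = sqrt \<beta> * \<bar>b - d\<bar>"
    using assms by (simp add: abs_mult flip: right_diff_distrib)
  finally show ?thesis by (simp add: n)
qed

text \<open>
  The vector field of the reduced system in the state \<open>(r, z, p\<^sub>r, p\<^sub>z)\<close>, with the positions to the
  left of \<open>c\<close> given the accelerations at \<open>r = c\<close>, which removes the singularity.
\<close>

definition clamped_field :: "real \<Rightarrow> real \<Rightarrow> real \<Rightarrow> real \<times> real \<times> real \<times> real \<Rightarrow> real \<times> real \<times> real \<times> real" where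
  "clamped_field c \<alpha> \<omega> = (\<lambda>(r, z, p, q). (p, q, acc_r \<alpha> \<omega> (max c r) z, acc_z \<alpha> (max c r) z))"

lemma clamped_field_lipschitz:
  assumes \<alpha>: "\<alpha> > 0" and c: "c > 0"
  obtains L where "L-lipschitz_on UNIV (clamped_field c \<alpha> \<omega>)"
proof -
  let ?X = "UNIV :: (real \<times> real \<times> real \<times> real) set"
  define R :: "real \<times> real \<times> real \<times> real \<Rightarrow> real" where "R x = max c (fst x)" for x
  define Z :: "real \<times> real \<times> real \<times> real \<Rightarrow> real" where "Z x = fst (snd x)" for x
  define \<beta> where "\<beta> = (\<alpha> + 2) / \<alpha>"
  define \<rho> where "\<rho> x = sqrt ((R x)^2 + \<beta> * (Z x)^2)" for x
  have \<beta>: "\<beta> > 0" using \<alpha> by (simp add: \<beta>_def)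
  have R: "R x \<ge> c" "R x > 0" for x using c by (auto simp: R_def)
  have \<rho>R: "R x \<le> \<rho> x" for x
    using rho_ge[OF \<alpha> R(2)] by (simp add: \<rho>_def \<beta>_def)
  have \<rho>: "\<rho> x \<ge> c" for x using R \<rho>R order_trans by blast
  have Z\<rho>: "\<bar>Z x\<bar> \<le> 1 / sqrt \<beta> * \<rho> x" for x
  proof -
    have "sqrt \<beta> * \<bar>Z x\<bar> = sqrt (\<beta> * (Z x)^2)" by (simp add: real_sqrt_mult)
    also have "\<dots> \<le> \<rho> x" unfolding \<rho>_def by simp
    finally show ?thesis using \<beta> by (simp add: field_simps)
  qed
  have lR: "1-lipschitz_on ?X R"
  proof (rule lipschitz_onI)
    fix x y
    have "\<bar>R x - R y\<bar> \<le> \<bar>fst x - fst y\<bar>" by (auto simp: R_def max_def)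
    also have "\<dots> \<le> dist x y" using dist_fst_le[of x y] by (simp add: dist_real_def)
    finally show "dist (R x) (R y) \<le> 1 * dist x y" by (simp add: dist_real_def)
  qed simp
  have lZ: "1-lipschitz_on ?X Z"
    by (rule lipschitz_onI) (simp_all add: Z_def order_trans[OF dist_fst_le dist_snd_le])
  have l\<rho>: "(1 + sqrt \<beta>)-lipschitz_on ?X \<rho>"
  proof (rule lipschitz_onI)
    fix x y
    have "\<bar>\<rho> x - \<rho> y\<bar> \<le> \<bar>R x - R y\<bar> + sqrt \<beta> * \<bar>Z x - Z y\<bar>"
      unfolding \<rho>_def by (rule rho_lipschitz) (use \<beta> in simp)
    also have "\<dots> \<le> 1 * dist x y + sqrt \<beta> * (1 * dist x y)"
      using lipschitz_onD[OF lR, of x y] lipschitz_onD[OF lZ, of x y] \<beta>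
      by (intro add_mono mult_left_mono) (auto simp: dist_real_def)
    finally show "dist (\<rho> x) (\<rho> y) \<le> (1 + sqrt \<beta>) * dist x y"
      by (simp add: dist_real_def algebra_simps)
  qed (use \<beta> in simp)
  have one: "0-lipschitz_on ?X (\<lambda>_. 1::real)" by (rule lipschitz_on_constant)
  have inv: "1 \<le> (1 / c) * u" if "c \<le> u" for u using c that by (simp add: field_simps)
  have q1: "bounded_lipschitz (\<lambda>x. 1 / R x)"
    by (rule bounded_lipschitz_quotient[OF one lR c, where K = "1 / c"]) (use R inv in auto)
  have q2: "bounded_lipschitz (\<lambda>x. 1 / \<rho> x)"
    by (rule bounded_lipschitz_quotient[OF one l\<rho> c, where K = "1 / c"]) (use \<rho> inv in auto)
  have q3: "bounded_lipschitz (\<lambda>x. R x / \<rho> x)"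
    by (rule bounded_lipschitz_quotient[OF lR l\<rho> c \<rho>, where K = 1])
       (use \<rho>R R(2) in \<open>simp add: abs_of_pos\<close>)
  have q4: "bounded_lipschitz (\<lambda>x. Z x / \<rho> x)"
    by (rule bounded_lipschitz_quotient[OF lZ l\<rho> c \<rho> Z\<rho>])
  have "bounded_lipschitz (\<lambda>x. \<omega>^2 * (1 / R x * (1 / R x) * (1 / R x)) - 1 / 2 * (1 / R x * (1 / R x))
      - 2 * \<alpha> * (R x / \<rho> x * (1 / \<rho> x) * (1 / \<rho> x)))"
    by (intro bounded_lipschitz_diff bounded_lipschitz_mult bounded_lipschitz_const q1 q2 q3)
  also have "(\<lambda>x. \<omega>^2 * (1 / R x * (1 / R x) * (1 / R x)) - 1 / 2 * (1 / R x * (1 / R x))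
      - 2 * \<alpha> * (R x / \<rho> x * (1 / \<rho> x) * (1 / \<rho> x))) = (\<lambda>x. acc_r \<alpha> \<omega> (R x) (Z x))"
    by (simp add: fun_eq_iff acc_r_def \<rho>_def \<beta>_def power2_eq_square power3_eq_cube)
  finally obtain La where La: "La-lipschitz_on ?X (\<lambda>x. acc_r \<alpha> \<omega> (R x) (Z x))"
    unfolding bounded_lipschitz_def by blast
  have "bounded_lipschitz (\<lambda>x. 0 - 2 * (\<alpha> + 2) * (Z x / \<rho> x * (1 / \<rho> x) * (1 / \<rho> x)))"
    by (intro bounded_lipschitz_diff bounded_lipschitz_mult bounded_lipschitz_const q2 q4)
  also have "(\<lambda>x. 0 - 2 * (\<alpha> + 2) * (Z x / \<rho> x * (1 / \<rho> x) * (1 / \<rho> x))) = (\<lambda>x. acc_z \<alpha> (R x) (Z x))"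
    by (simp add: fun_eq_iff acc_z_def \<rho>_def \<beta>_def power2_eq_square power3_eq_cube)
  finally obtain Lb where Lb: "Lb-lipschitz_on ?X (\<lambda>x. acc_z \<alpha> (R x) (Z x))"
    unfolding bounded_lipschitz_def by blast
  have lP: "1-lipschitz_on ?X (\<lambda>x. fst (snd (snd x)))"
    by (rule lipschitz_onI)
       (simp_all add: order_trans[OF dist_fst_le order_trans[OF dist_snd_le dist_snd_le]])
  have lQ: "1-lipschitz_on ?X (\<lambda>x. snd (snd (snd x)))"
    by (rule lipschitz_onI)
       (simp_all add: order_trans[OF dist_snd_le order_trans[OF dist_snd_le dist_snd_le]])
  show ?thesis
    by (rule that[OF lipschitz_on_transform[OF lipschitz_on_Pair[OF lP lipschitz_on_Pair[OF lQ lipschitz_on_Pair[OF La Lb]]]]])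
       (auto simp: clamped_field_def R_def Z_def)
qed

section \<open>Energy levels with compact Hill region\<close>

locale isosceles_level =
  fixes \<alpha> \<omega> h :: real
  assumes \<omega>_pos: "\<omega> > 0" and \<alpha>_pos: "\<alpha> > 0"
    and h_gt: "- ((1 + 4 * \<alpha>)^2 / (8 * \<omega>^2)) < h"
    and h_lt: "h < - (1 / (8 * \<omega>^2))"
begin

text \<open>
  In the plane \<open>z = 0\<close> the system is a Kepler problem with force constant \<open>kepler_mass\<close>. Its orbits
  with angular momentum \<open>\<omega>\<close> and energy \<open>h\<close> have the semi-latus rectum \<open>semi_latus_rectum\<close> and move
  between the pericentre \<open>r_min\<close> and the apocentre \<open>r_max\<close>. The number \<open>gap\<close> tells how far \<open>h\<close> lies
  below the infimum of the energies at which \<open>z\<close> can escape to infinity.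
\<close>

definition "kepler_mass = 2 * \<alpha> + 1 / 2"
definition "semi_latus_rectum = \<omega>^2 / kepler_mass"
definition "r_min = \<omega>^2 / (kepler_mass + sqrt (kepler_mass^2 + 2 * h * \<omega>^2))"
definition "r_max = \<omega>^2 / (kepler_mass - sqrt (kepler_mass^2 + 2 * h * \<omega>^2))"
definition "gap = - (1 / (8 * \<omega>^2)) - h"

lemma kepler_mass_pos: "kepler_mass > 0"
  using \<alpha>_pos by (simp add: kepler_mass_def)

lemma gap_pos: "gap > 0"
  using h_lt by (simp add: gap_def)

lemma h_neg: "h < 0"
proof -
  have "1 / (8 * \<omega>^2) > 0" using \<omega>_pos by simp
  then show ?thesis using h_lt by linarith
qed

lemma discriminant_bounds:
  "0 < sqrt (kepler_mass^2 + 2 * h * \<omega>^2)" "sqrt (kepler_mass^2 + 2 * h * \<omega>^2) < kepler_mass"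
proof -
  have "- (kepler_mass^2 / (2 * \<omega>^2)) < h"
    using h_gt by (simp add: kepler_mass_def power2_eq_square field_simps)
  then show "0 < sqrt (kepler_mass^2 + 2 * h * \<omega>^2)"
    using \<omega>_pos by (simp add: field_simps)
  have "kepler_mass^2 + 2 * h * \<omega>^2 < kepler_mass^2"
    using h_neg \<omega>_pos by (simp add: mult_neg_pos)
  then show "sqrt (kepler_mass^2 + 2 * h * \<omega>^2) < kepler_mass"
    using kepler_mass_pos by (metis real_sqrt_less_mono real_sqrt_unique less_imp_le)
qed

lemma turning_points_order: "0 < r_min" "r_min < semi_latus_rectum" "semi_latus_rectum < r_max"
  unfolding r_min_def r_max_def semi_latus_rectum_def
  using discriminant_bounds \<omega>_pos kepler_mass_pos add_pos_pos[OF kepler_mass_pos discriminant_bounds(1)]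
  by (auto intro!: divide_strict_left_mono mult_pos_pos divide_pos_pos)

lemma planar_potential: "r > 0 \<Longrightarrow> reduced_V \<alpha> \<omega> r 0 = \<omega>^2 / (2 * r^2) - kepler_mass / r"
  by (simp add: reduced_V_def kepler_mass_def field_simps)

lemma planar_potential_factored:
  assumes "r > 0"
  shows "reduced_V \<alpha> \<omega> r 0 - h = \<omega>^2 / 2 * ((1 / r - 1 / r_min) * (1 / r - 1 / r_max))"
proof -
  define s where "s = sqrt (kepler_mass^2 + 2 * h * \<omega>^2)"
  have s2: "s^2 = kepler_mass^2 + 2 * h * \<omega>^2"
    using discriminant_bounds(1) by (simp add: s_def less_imp_le)
  have "1 / r_min = (kepler_mass + s) / \<omega>^2" "1 / r_max = (kepler_mass - s) / \<omega>^2"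
    by (simp_all add: r_min_def r_max_def s_def)
  moreover have "(u - (kepler_mass + s) / w) * (u - (kepler_mass - s) / w)
      = u^2 - 2 * kepler_mass / w * u + (kepler_mass^2 - s^2) / w^2" if "w \<noteq> 0" for u w
    using that by (simp add: power2_eq_square field_simps)
  from this[of "\<omega>^2" "1 / r"] \<omega>_pos
  have "(1 / r - (kepler_mass + s) / \<omega>^2) * (1 / r - (kepler_mass - s) / \<omega>^2)
      = (1 / r)^2 - 2 * kepler_mass / \<omega>^2 * (1 / r) + (kepler_mass^2 - s^2) / (\<omega>^2)^2"
    by simp
  ultimately have "(1 / r - 1 / r_min) * (1 / r - 1 / r_max)
      = (1 / r)^2 - 2 * kepler_mass / \<omega>^2 * (1 / r) + (kepler_mass^2 - s^2) / (\<omega>^2)^2"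
    by simp
  also have "(kepler_mass^2 - s^2) / (\<omega>^2)^2 = - (2 * h / \<omega>^2)"
    unfolding s2 using \<omega>_pos by (simp add: power2_eq_square field_simps)
  finally have *: "(1 / r - 1 / r_min) * (1 / r - 1 / r_max) = 
      (1 / r)^2 - 2 * kepler_mass / \<omega>^2 * (1 / r) - 2 * h / \<omega>^2" by simp
  show ?thesis
    unfolding * planar_potential[OF assms] using \<omega>_pos assms
    by (simp add: power2_eq_square field_simps)
qed

lemma r_max_pos: "r_max > 0"
  using turning_points_order by linarith

lemma planar_potential_less_iff:
  assumes "r > 0"
  shows "reduced_V \<alpha> \<omega> r 0 < h \<longleftrightarrow> r_min < r \<and> r < r_max"
proof -
  have "reduced_V \<alpha> \<omega> r 0 < h \<longleftrightarrow> (1 / r - 1 / r_min) * (1 / r - 1 / r_max) < 0"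
    using planar_potential_factored[OF assms] \<omega>_pos
    by (smt (verit) half_gt_zero_iff mult_less_0_iff zero_less_power)
  also have "\<dots> \<longleftrightarrow> 1 / r < 1 / r_min \<and> 1 / r > 1 / r_max"
  proof -
    have "1 / r_max < 1 / r_min"
      using turning_points_order by (intro divide_strict_left_mono mult_pos_pos) auto
    then show ?thesis by (auto simp: mult_less_0_iff)
  qed
  also have "\<dots> \<longleftrightarrow> r_min < r \<and> r < r_max"
    using assms turning_points_order r_max_pos by (auto simp: field_simps)
  finally show ?thesis .
qed

lemma planar_potential_turning_points: "reduced_V \<alpha> \<omega> r_min 0 = h" "reduced_V \<alpha> \<omega> r_max 0 = h"
  using planar_potential_factored[of r_min] planar_potential_factored[of r_max] turning_points_order
  by auto

lemma planar_potential_le_iff: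
  assumes "r > 0"
  shows "reduced_V \<alpha> \<omega> r 0 \<le> h \<longleftrightarrow> r_min \<le> r \<and> r \<le> r_max"
proof (cases "r = r_min \<or> r = r_max")
  case True
  then show ?thesis using planar_potential_turning_points turning_points_order by auto
next
  case False
  then have "(1 / r - 1 / r_min) * (1 / r - 1 / r_max) \<noteq> 0"
    using assms turning_points_order r_max_pos by auto
  then have "reduced_V \<alpha> \<omega> r 0 \<noteq> h"
    using planar_potential_factored[OF assms] \<omega>_pos by auto
  then show ?thesis
    using planar_potential_less_iff[OF assms] False by linarith
qed

text \<open>
  The function \<open>\<omega>^2 / (2 * r^2) - 1 / (2 * r)\<close>, the limit of the potential for \<open>\<bar>z\<bar> \<rightarrow> \<infinity>\<close>, has its
  minimum \<open>- 1 / (8 * \<omega>^2)\<close> at \<open>r = 2 * \<omega>^2\<close>; this is seen by completing the square in \<open>1 / r\<close>.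
\<close>

lemma clearance_ge_gap:
  assumes "r > 0"
  shows "gap \<le> \<omega>^2 / (2 * r^2) - 1 / (2 * r) - h"
proof -
  have "\<omega>^2 / (2 * r^2) - 1 / (2 * r) + 1 / (8 * \<omega>^2) = \<omega>^2 / 2 * (1 / r - 1 / (2 * \<omega>^2))^2"
    using assms \<omega>_pos by (simp add: power2_eq_square field_simps)
  also have "\<dots> \<ge> 0" by simp
  finally show ?thesis by (simp add: gap_def)
qed

text \<open>
  Compactness of the Hill region. The bounds on \<open>r\<close> hold because for fixed \<open>r\<close> the potential is
  smallest at \<open>z = 0\<close>. The distance from the singularity and the bound on \<open>z\<close> make
  all later estimates uniform over the energy level.
\<close>

lemma hill_region_bounds:
  assumes "r > 0" "reduced_V \<alpha> \<omega> r z \<le> h"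
  shows "r_min \<le> r" "r \<le> r_max" "sqrt (r^2 + (\<alpha> + 2) / \<alpha> * z^2) \<le> 2 * \<alpha> / gap"
proof -
  let ?\<rho> = "sqrt (r^2 + (\<alpha> + 2) / \<alpha> * z^2)"
  have \<rho>: "r \<le> ?\<rho>" "?\<rho> > 0" using rho_ge[OF \<alpha>_pos assms(1), of z] assms(1) by linarith+
  have "2 * \<alpha> / ?\<rho> \<le> 2 * \<alpha> / r"
    using \<rho> assms(1) \<alpha>_pos by (intro divide_left_mono) auto
  then have "reduced_V \<alpha> \<omega> r 0 \<le> reduced_V \<alpha> \<omega> r z"
    using assms(1) by (simp add: reduced_V_def)
  then show "r_min \<le> r" "r \<le> r_max"
    using planar_potential_le_iff[OF assms(1)] assms(2) by linarith+
  have "gap \<le> 2 * \<alpha> / ?\<rho>"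
    using clearance_ge_gap[OF assms(1)] assms(2) by (simp add: reduced_V_def)
  then show "?\<rho> \<le> 2 * \<alpha> / gap"
    using gap_pos \<rho>(2) by (simp add: field_simps)
qed

definition level_solution :: "(real \<Rightarrow> real) \<Rightarrow> (real \<Rightarrow> real) \<Rightarrow> (real \<Rightarrow> real) \<Rightarrow> (real \<Rightarrow> real) \<Rightarrow> bool" where
  "level_solution r z p q \<longleftrightarrow> reduced_solution \<alpha> \<omega> r z p q \<and> reduced_H \<alpha> \<omega> (r 0) (z 0) (p 0) (q 0) = h"

lemma level_solutionD:
  assumes "level_solution r z p q"
  shows "r t > 0" "(r has_real_derivative p t) (at t)" "(z has_real_derivative q t) (at t)"
    "(p has_real_derivative acc_r \<alpha> \<omega> (r t) (z t)) (at t)"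
    "(q has_real_derivative acc_z \<alpha> (r t) (z t)) (at t)"
  using assms by (auto simp: level_solution_def reduced_solution_iff[OF \<alpha>_pos])

lemma level_solution_energy:
  assumes "level_solution r z p q"
  shows "reduced_H \<alpha> \<omega> (r t) (z t) (p t) (q t) = h"
  using assms reduced_H_conserved[OF \<alpha>_pos] unfolding level_solution_def by metis

lemma reduced_V_le_reduced_H: "reduced_V \<alpha> \<omega> r z \<le> reduced_H \<alpha> \<omega> r z p q"
  by (simp add: reduced_H_def)

lemma level_solution_bounds:
  assumes "level_solution r z p q"
  shows "r_min \<le> r t" "r t \<le> r_max" "sqrt ((r t)^2 + (\<alpha> + 2) / \<alpha> * (z t)^2) \<le> 2 * \<alpha> / gap"
proof -
  have "reduced_V \<alpha> \<omega> (r t) (z t) \<le> h"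
    using reduced_V_le_reduced_H level_solution_energy[OF assms] by metis
  from hill_region_bounds[OF level_solutionD(1)[OF assms] this]
  show "r_min \<le> r t" "r t \<le> r_max" "sqrt ((r t)^2 + (\<alpha> + 2) / \<alpha> * (z t)^2) \<le> 2 * \<alpha> / gap" .
qed

lemma level_solution_clamped:
  assumes "level_solution r z p q"
  shows "((\<lambda>t. (r t, z t, p t, q t)) has_vector_derivative
           clamped_field (r_min / 2) \<alpha> \<omega> (r t, z t, p t, q t)) (at t)"
proof -
  have "max (r_min / 2) (r t) = r t"
    using level_solution_bounds(1)[OF assms, of t] turning_points_order(1) by simp
  then show ?thesis
    using level_solutionD[OF assms, of t]
    by (auto simp: clamped_field_def has_real_derivative_iff_has_vector_derivative intro!: derivative_intros)
qed

text \<open>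
  One constant \<open>L\<close> serves all solutions on the energy level, since they all solve the equation of the
  same clamped field.
\<close>

lemma level_solution_dependence:
  obtains L where "L \<ge> 0" and "\<And>r z p q r' z' p' q' t.
    level_solution r z p q \<Longrightarrow> level_solution r' z' p' q' \<Longrightarrow>
    dist (r t, z t, p t, q t) (r' t, z' t, p' t, q' t)
      \<le> exp (L * \<bar>t\<bar>) * dist (r 0, z 0, p 0, q 0) (r' 0, z' 0, p' 0, q' 0)"
proof -
  obtain L where L: "L-lipschitz_on UNIV (clamped_field (r_min / 2) \<alpha> \<omega>)"
    using clamped_field_lipschitz[OF \<alpha>_pos] turning_points_order(1) by (metis half_gt_zero)
  show ?thesis
    by (rule that[OF lipschitz_on_nonneg[OF L]])
       (rule lipschitz_ode_dependence[OF L level_solution_clamped level_solution_clamped])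
qed

lemma level_solution_unique:
  assumes "level_solution r z p q" "level_solution r' z' p' q'"
    and "r 0 = r' 0" "z 0 = z' 0" "p 0 = p' 0" "q 0 = q' 0"
  shows "r t = r' t" "z t = z' t" "p t = p' t" "q t = q' t"
proof -
  obtain L where "dist (r t, z t, p t, q t) (r' t, z' t, p' t, q' t)
      \<le> exp (L * \<bar>t\<bar>) * dist (r 0, z 0, p 0, q 0) (r' 0, z' 0, p' 0, q' 0)"
    using level_solution_dependence assms(1,2) by metis
  then have "(r t, z t, p t, q t) = (r' t, z' t, p' t, q' t)"
    using assms(3-) by simp
  then show "r t = r' t" "z t = z' t" "p t = p' t" "q t = q' t" by simp_all
qed

text \<open>
  The solution is taken from the clamped field. The set of times at which \<open>r \<ge> r_min\<close> and the energy
  is \<open>h\<close> is closed. It is also open: near such a time the clamping is inactive, so energy is conserved,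
  and then the Hill region forces \<open>r \<ge> r_min\<close> again. Hence it is the whole time axis, and the clamping
  is never felt.
\<close>

lemma brake_solution_exists:
  assumes "r0 > 0" "reduced_V \<alpha> \<omega> r0 z0 = h"
  obtains r z p q where "level_solution r z p q" "r 0 = r0" "z 0 = z0" "p 0 = 0" "q 0 = 0"
proof -
  let ?f = "clamped_field (r_min / 2) \<alpha> \<omega>"
  obtain L where L: "L-lipschitz_on UNIV ?f"
    using clamped_field_lipschitz[OF \<alpha>_pos] turning_points_order(1) by (metis half_gt_zero)
  obtain x where x0: "x 0 = (r0, z0, 0, 0)" and x: "\<And>t. (x has_vector_derivative ?f (x t)) (at t)"
    using lipschitz_ode_global_solution[OF L, of "(r0, z0, 0, 0)"] by blast
  define r where "r t = fst (x t)" for t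
  define z where "z t = fst (snd (x t))" for t
  define p where "p t = fst (snd (snd (x t)))" for t
  define q where "q t = snd (snd (snd (x t)))" for t
  have xt: "x t = (r t, z t, p t, q t)" for t
    by (simp add: r_def z_def p_def q_def)
  note bl = bounded_linear.has_vector_derivative
  have d: "(r has_real_derivative p t) (at t)" "(z has_real_derivative q t) (at t)"
    "(p has_real_derivative acc_r \<alpha> \<omega> (max (r_min / 2) (r t)) (z t)) (at t)"
    "(q has_real_derivative acc_z \<alpha> (max (r_min / 2) (r t)) (z t)) (at t)" for t
    using bl[OF bounded_linear_fst x, of t]
      bl[OF bounded_linear_fst bl[OF bounded_linear_snd x], of t]
      bl[OF bounded_linear_fst bl[OF bounded_linear_snd bl[OF bounded_linear_snd x]], of t]
      bl[OF bounded_linear_snd bl[OF bounded_linear_snd bl[OF bounded_linear_snd x]], of t]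
    unfolding has_real_derivative_iff_has_vector_derivative r_def[symmetric] z_def[symmetric]
      p_def[symmetric] q_def[symmetric]
    by (simp_all add: xt clamped_field_def)
  define E where "E t = reduced_H \<alpha> \<omega> (r t) (z t) (p t) (q t)" for t
  define S where "S = {t. r_min \<le> r t \<and> E t = h}"
  have contr: "continuous_on UNIV r" and contz: "continuous_on UNIV z"
    and contp: "continuous_on UNIV p" and contq: "continuous_on UNIV q"
    using d by (auto intro!: continuous_at_imp_continuous_on DERIV_isCont)
  have E': "(E has_real_derivative 0) (at t)" if "r t \<ge> r_min / 2" for t
  proof -
    have rt: "r t > 0" using that turning_points_order(1) by linarith
    have "max (r_min / 2) (r t) = r t" using that by simp
    then show ?thesis
      unfolding E_def reduced_H_def
      using reduced_V_along_curve[where \<omega> = \<omega>, OF \<alpha>_pos rt d(1,2)] d(3,4)[of t]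
      by (auto intro!: derivative_eq_intros simp: add_divide_distrib)
  qed
  have r_ge: "r_min \<le> r t" if "r t > 0" "E t = h" for t
    using hill_region_bounds(1)[OF that(1)] reduced_V_le_reduced_H that(2) unfolding E_def by metis
  have "open S"
    unfolding open_contains_ball
  proof
    fix t assume t: "t \<in> S"
    have "open {u. r_min / 2 < r u}"
      using contr by (intro open_Collect_less continuous_intros) 
    moreover have "t \<in> {u. r_min / 2 < r u}"
      using t turning_points_order(1) by (simp add: S_def)
    ultimately obtain e where e: "e > 0" "ball t e \<subseteq> {u. r_min / 2 < r u}"
      unfolding open_contains_ball by blast
    have "E u = E t" if "u \<in> ball t e" for u
    proof -
      have "\<exists>c. \<forall>u\<in>ball t e. E u = c"
        by (rule has_field_derivative_zero_constant)
           (use e(2) in \<open>auto intro!: has_field_derivative_at_within E' less_imp_le\<close>)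
      then show ?thesis using that e(1) by auto
    qed
    then have Eu: "E u = h" if "u \<in> ball t e" for u
      using t that by (simp add: S_def)
    have "ball t e \<subseteq> S"
    proof
      fix u assume u: "u \<in> ball t e"
      then have "r_min / 2 < r u" using e(2) by blast
      then have "r u > 0" using turning_points_order(1) by linarith
      then show "u \<in> S" using r_ge Eu[OF u] by (simp add: S_def)
    qed
    then show "\<exists>e>0. ball t e \<subseteq> S"
      using e(1) by blast
  qed
  moreover have "closed S"
  proof -
    \<comment> \<open>The energy is continuous where \<open>r\<close> is positive; cutting off at \<open>r_min\<close> makes it continuous everywhere without changing \<open>S\<close>.\<close>
    define E2 where "E2 t = reduced_H \<alpha> \<omega> (max r_min (r t)) (z t) (p t) (q t)" for t
    have "S = {t. r_min \<le> r t} \<inter> {t. E2 t = h}"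
      by (auto simp: S_def E_def E2_def)
    moreover have "continuous_on UNIV E2"
    proof -
      have "max r_min (r t) > 0" for t using turning_points_order(1) by simp
      moreover from rho_pos[OF \<alpha>_pos this]
      have "(max r_min (r t))\<^sup>2 + (\<alpha> + 2) / \<alpha> * (z t)\<^sup>2 \<noteq> 0" for t
        by (metis less_irrefl)
      ultimately show ?thesis
        unfolding E2_def reduced_H_def reduced_V_def using contr contz contp contq
        by (intro continuous_intros) (auto simp: less_imp_neq[symmetric])
    qed
    ultimately show ?thesis
      using contr by (auto intro!: closed_Int closed_Collect_le closed_Collect_eq continuous_intros)
  qed
  moreover have "0 \<in> S"
    using x0 xt[of 0] assms hill_region_bounds(1)[OF assms(1), of z0]
    by (simp add: S_def E_def reduced_H_def)
  ultimately have "S = UNIV"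
    using connected_clopen[of "UNIV :: real set"] by (auto simp: connected_UNIV)
  then have S: "r_min \<le> r t" "E t = h" for t by (auto simp: S_def)
  have "max (r_min / 2) (r t) = r t" for t
    using S(1)[of t] turning_points_order(1) by simp
  then have "level_solution r z p q"
    using d S turning_points_order(1) order_less_le_trans[OF turning_points_order(1) S(1)]
    by (auto simp: level_solution_def reduced_solution_iff[OF \<alpha>_pos] E_def)
  then show ?thesis
    using that x0 xt[of 0] by simp
qed

end

section \<open>First crossing of the horizontal plane\<close>

lemma dist_components:
  fixes r z p q r' z' p' q' :: real
  shows "\<bar>r - r'\<bar> \<le> dist (r, z, p, q) (r', z', p', q')"
    "\<bar>z - z'\<bar> \<le> dist (r, z, p, q) (r', z', p', q')"
    "\<bar>p - p'\<bar> \<le> dist (r, z, p, q) (r', z', p', q')"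
proof -
  let ?x = "(r, z, p, q)" and ?y = "(r', z', p', q')"
  show "\<bar>r - r'\<bar> \<le> dist ?x ?y"
    using dist_fst_le[of ?x ?y] by (simp add: dist_real_def)
  show "\<bar>z - z'\<bar> \<le> dist ?x ?y"
    using order_trans[OF dist_fst_le[of "snd ?x" "snd ?y"] dist_snd_le[of ?x ?y]]
    by (simp add: dist_real_def)
  show "\<bar>p - p'\<bar> \<le> dist ?x ?y"
    using order_trans[OF dist_fst_le[of "snd (snd ?x)" "snd (snd ?y)"]
        order_trans[OF dist_snd_le[of "snd ?x" "snd ?y"] dist_snd_le[of ?x ?y]]]
    by (simp add: dist_real_def)
qed

definition first_zero :: "(real \<Rightarrow> real) \<Rightarrow> real \<Rightarrow> bool" where
  "first_zero f \<tau> \<longleftrightarrow> 0 < \<tau> \<and> f \<tau> = 0 \<and> (\<forall>t. 0 \<le> t \<longrightarrow> t < \<tau> \<longrightarrow> 0 < f t)"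

lemma first_zero_exists:
  assumes cont: "continuous_on UNIV f" and "f 0 > 0" "b \<ge> 0" "f b \<le> 0"
  obtains \<tau> where "first_zero f \<tau>" "\<tau> \<le> b"
proof -
  let ?S = "{0..b} \<inter> {t. f t \<le> 0}"
  have "closed {t. f t \<le> 0}"
    using cont by (intro closed_Collect_le continuous_intros)
  then have "compact ?S" by (intro compact_Int_closed) auto
  moreover have "?S \<noteq> {}" using assms by auto
  ultimately obtain \<tau> where \<tau>: "\<tau> \<in> ?S" "\<And>t. t \<in> ?S \<Longrightarrow> \<tau> \<le> t"
    using compact_attains_inf by metis
  have "\<tau> \<noteq> 0" using \<tau>(1) assms(2) by auto
  then have pos: "\<tau> > 0" using \<tau>(1) by auto
  have before: "0 < f t" if "0 \<le> t" "t < \<tau>" for t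
    using \<tau>(2)[of t] \<tau>(1) that by force
  obtain s where s: "0 \<le> s" "s \<le> \<tau>" "f s = 0"
    using IVT2'[of f \<tau> 0 0] \<tau>(1) assms(2) pos cont continuous_on_subset by fastforce
  then have "s = \<tau>" using before[of s] by fastforce
  then show ?thesis
    using that[of \<tau>] s pos before \<tau>(1) by (auto simp: first_zero_def)
qed

context isosceles_level
begin

lemma level_solution_continuous:
  assumes "level_solution r z p q"
  shows "continuous_on UNIV r" "continuous_on UNIV z" "continuous_on UNIV p" "continuous_on UNIV q"
  using level_solutionD[OF assms]
  by (auto intro!: continuous_at_imp_continuous_on DERIV_isCont)

lemma level_solution_shift:
  assumes "level_solution r z p q"
  shows "level_solution (\<lambda>t. r (t + a)) (\<lambda>t. z (t + a)) (\<lambda>t. p (t + a)) (\<lambda>t. q (t + a))"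
  unfolding level_solution_def reduced_solution_iff[OF \<alpha>_pos]
  using level_solutionD[OF assms] level_solution_energy[OF assms]
  by (auto intro!: DERIV_shift[THEN iffD1])

lemma level_solution_reflect:
  assumes "level_solution r z p q"
  shows "level_solution r (\<lambda>t. - z t) p (\<lambda>t. - q t)"
proof -
  have even: "acc_r \<alpha> \<omega> r (- z) = acc_r \<alpha> \<omega> r z" "reduced_H \<alpha> \<omega> r (- z) p (- q) = reduced_H \<alpha> \<omega> r z p q"
    and odd: "acc_z \<alpha> r (- z) = - acc_z \<alpha> r z" for r z p q
    by (simp_all add: acc_r_def acc_z_def reduced_H_def reduced_V_def)
  show ?thesis
    unfolding level_solution_def reduced_solution_iff[OF \<alpha>_pos] even odd
    using level_solutionD[OF assms] level_solution_energy[OF assms, of 0]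
    by (auto intro!: DERIV_minus)
qed

lemma level_solution_reverse:
  assumes "level_solution r z p q"
  shows "level_solution (\<lambda>t. r (- t)) (\<lambda>t. z (- t)) (\<lambda>t. - p (- t)) (\<lambda>t. - q (- t))"
proof -
  have rev: "((\<lambda>t. f (- t)) has_real_derivative - D) (at t)"
    if "(f has_real_derivative D) (at (- t))" for f D t
    using that has_vector_derivative_time_reversal
    unfolding has_real_derivative_iff_has_vector_derivative by blast
  have rev': "((\<lambda>t. - f (- t)) has_real_derivative D) (at t)"
    if "(f has_real_derivative D) (at (- t))" for f D t
    using DERIV_minus[OF rev[OF that]] by simp
  show ?thesis
    unfolding level_solution_def reduced_solution_iff[OF \<alpha>_pos]
    using level_solutionD[OF assms] level_solution_energy[OF assms, of 0]
    by (auto intro!: rev rev' simp: reduced_H_def)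
qed

text \<open>
  Time reversal at the instant of rest makes \<open>r\<close> and \<open>z\<close> even functions. The perpendicular crossing
  at \<open>\<tau>\<close> makes the orbit invariant under reversal of time about \<open>\<tau>\<close> combined with \<open>z \<mapsto> - z\<close>. The
  composition of the two symmetries is a time shift by \<open>2 * \<tau>\<close> combined with \<open>z \<mapsto> - z\<close>, whose square
  is the shift by \<open>4 * \<tau>\<close>.
\<close>

lemma symmetric_solution_periodic:
  assumes sol: "level_solution r z p q"
    and brake: "p 0 = 0" "q 0 = 0" and cross: "z \<tau> = 0" "p \<tau> = 0"
  shows "r (t + 4 * \<tau>) = r t" "z (t + 4 * \<tau>) = z t" "p (t + 4 * \<tau>) = p t" "q (t + 4 * \<tau>) = q t"
proof -
  note even = level_solution_unique[OF level_solution_reverse[OF sol] sol]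
  have e: "r (- t) = r t" "z (- t) = z t" "- p (- t) = p t" "- q (- t) = q t" for t
    using even[of t] brake by simp_all
  note odd = level_solution_unique[OF level_solution_shift[OF sol, of \<tau>]
      level_solution_reflect[OF level_solution_reverse[OF level_solution_shift[OF sol, of \<tau>]]]]
  have o: "r (t + \<tau>) = r (- t + \<tau>)" "z (t + \<tau>) = - z (- t + \<tau>)"
    "p (t + \<tau>) = - p (- t + \<tau>)" "q (t + \<tau>) = q (- t + \<tau>)" for t
    using odd[of t] cross by simp_all
  have half: "r (t + 2 * \<tau>) = r t" "z (t + 2 * \<tau>) = - z t" "p (t + 2 * \<tau>) = p t"
    "q (t + 2 * \<tau>) = - q t" for t
    using o[of "t + \<tau>"] e[of t] by (simp_all add: algebra_simps)
  show "r (t + 4 * \<tau>) = r t" "z (t + 4 * \<tau>) = z t" "p (t + 4 * \<tau>) = p t" "q (t + 4 * \<tau>) = q t"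
    using half[of "t + 2 * \<tau>"] half[of t] by (simp_all add: algebra_simps)
qed

text \<open>
  Bounds for the coefficient \<open>2 * (\<alpha> + 2) / \<rho>^3\<close> in \<open>z'' = - 2 * (\<alpha> + 2) / \<rho>^3 * z\<close> over the energy
  level, and the quarter periods of the harmonic oscillators with these squared frequencies. The
  crossing time of any orbit released at rest lies between the two quarter periods.
\<close>

definition "stiffness_min = 2 * (\<alpha> + 2) / (2 * \<alpha> / gap)^3"
definition "stiffness_max = 2 * (\<alpha> + 2) / r_min^3"
definition "\<tau>_max = pi / (2 * sqrt stiffness_min)"
definition "\<tau>_min = pi / (2 * sqrt stiffness_max)"

lemma stiffness_pos: "stiffness_min > 0" "stiffness_max > 0"
  using \<alpha>_pos gap_pos turning_points_order(1)
  by (simp_all add: stiffness_min_def stiffness_max_def)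

lemma \<tau>_bounds_pos: "\<tau>_max > 0" "\<tau>_min > 0"
  using stiffness_pos by (simp_all add: \<tau>_max_def \<tau>_min_def)

lemma acc_z_bounds:
  assumes "level_solution r z p q" "z t \<ge> 0"
  shows "acc_z \<alpha> (r t) (z t) \<le> - (stiffness_min * z t)"
    "- (stiffness_max * z t) \<le> acc_z \<alpha> (r t) (z t)"
proof -
  define \<rho> where "\<rho> = sqrt ((r t)^2 + (\<alpha> + 2) / \<alpha> * (z t)^2)"
  have "r_min \<le> \<rho>" "\<rho> \<le> 2 * \<alpha> / gap"
    using level_solution_bounds[OF assms(1), of t] rho_ge[OF \<alpha>_pos level_solutionD(1)[OF assms(1), of t], of "z t"]
    unfolding \<rho>_def by linarith+
  then have "r_min^3 \<le> \<rho>^3" "\<rho>^3 \<le> (2 * \<alpha> / gap)^3" "0 < \<rho>"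
    using turning_points_order(1) by (auto intro!: power_mono)
  moreover have "0 \<le> 2 * (\<alpha> + 2)" using \<alpha>_pos by simp
  moreover have "acc_z \<alpha> (r t) (z t) = - (2 * (\<alpha> + 2) / \<rho>^3 * z t)"
    by (simp add: acc_z_def \<rho>_def)
  ultimately show "acc_z \<alpha> (r t) (z t) \<le> - (stiffness_min * z t)"
    "- (stiffness_max * z t) \<le> acc_z \<alpha> (r t) (z t)"
    using \<alpha>_pos assms(2) turning_points_order(1) gap_pos
    by (auto simp only: stiffness_min_def stiffness_max_def neg_le_iff_le
        intro!: mult_right_mono divide_left_mono mult_pos_pos zero_less_power divide_pos_pos)
qed

text \<open>
  The function differentiated is the Wronskian, up to sign, of \<open>z\<close> and the solution \<open>cos (w * t)\<close> of
  \<open>c'' = - w^2 * c\<close>; its derivative has the sign of \<open>z'' + w^2 * z\<close> up to the quarter period.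
\<close>

lemma oscillator_comparison_derivative:
  assumes "level_solution r z p q"
  shows "((\<lambda>t. q t * cos (w * t) + w * z t * sin (w * t)) has_real_derivative
           (acc_z \<alpha> (r t) (z t) + w^2 * z t) * cos (w * t)) (at t)"
  using level_solutionD(3,5)[OF assms, of t]
  by (auto intro!: derivative_eq_intros simp: algebra_simps power2_eq_square)

text \<open>
  Otherwise \<open>z\<close> stays positive up to the quarter period of the slower oscillator. The Wronskian with it
  is then nonincreasing and starts at \<open>0\<close>, but ends at a positive multiple of \<open>z\<close>.
\<close>

lemma crossing_exists:
  assumes sol: "level_solution r z p q" and z0: "z 0 > 0" "q 0 = 0"
  obtains \<tau> where "first_zero z \<tau>" "\<tau> \<le> \<tau>_max"
proof -
  have "\<exists>b. 0 \<le> b \<and> b \<le> \<tau>_max \<and> z b \<le> 0"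
  proof (rule ccontr)
    assume "\<not> ?thesis"
    then have pos: "z t > 0" if "0 \<le> t" "t \<le> \<tau>_max" for t
      using that by force
    define w where "w = sqrt stiffness_min"
    have w: "w > 0" "w^2 = stiffness_min" using stiffness_pos by (simp_all add: w_def)
    have w\<tau>: "w * \<tau>_max = pi / 2" using w by (simp add: \<tau>_max_def w_def[symmetric])
    have "q \<tau>_max * cos (w * \<tau>_max) + w * z \<tau>_max * sin (w * \<tau>_max)
        \<le> q 0 * cos (w * 0) + w * z 0 * sin (w * 0)"
    proof (rule DERIV_nonpos_imp_nonincreasing[where f = "\<lambda>t. q t * cos (w * t) + w * z t * sin (w * t)"])
      fix t assume t: "0 \<le> t" "t \<le> \<tau>_max"
      have "w * t \<le> pi / 2" using t w w\<tau> by (metis mult_left_mono less_imp_le)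
      then have "cos (w * t) \<ge> 0"
        using mult_nonneg_nonneg[of w t] t w pi_gt_zero by (intro cos_ge_zero) linarith+
      moreover have "acc_z \<alpha> (r t) (z t) + w^2 * z t \<le> 0"
        using acc_z_bounds(1)[OF sol, of t] pos[OF t] w(2) by simp
      ultimately have "(acc_z \<alpha> (r t) (z t) + w^2 * z t) * cos (w * t) \<le> 0"
        by (rule mult_nonpos_nonneg[rotated])
      then show "\<exists>y. ((\<lambda>t. q t * cos (w * t) + w * z t * sin (w * t)) has_real_derivative y) (at t) \<and> y \<le> 0"
        using oscillator_comparison_derivative[OF sol] by blast
    qed (use \<tau>_bounds_pos in simp)
    then have "w * z \<tau>_max \<le> 0" by (simp add: w\<tau> z0)
    then show False using w pos[of \<tau>_max] \<tau>_bounds_pos by (simp add: mult_le_0_iff)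
  qed
  then obtain b where b: "0 \<le> b" "b \<le> \<tau>_max" "z b \<le> 0" by blast
  obtain \<tau> where "first_zero z \<tau>" "\<tau> \<le> b"
    by (rule first_zero_exists[OF level_solution_continuous(2)[OF sol] z0(1) b(1,3)])
  then show ?thesis
    using that b(2) order_trans by blast
qed

lemma crossing_velocity_neg:
  assumes sol: "level_solution r z p q" and q0: "q 0 = 0" and \<tau>: "first_zero z \<tau>"
  shows "q \<tau> < 0"
proof -
  have "q 0 > q \<tau>"
  proof (rule DERIV_neg_imp_decreasing_open[where f = q])
    fix t assume t: "0 < t" "t < \<tau>"
    then have "z t > 0" using \<tau> by (simp add: first_zero_def)
    then have "acc_z \<alpha> (r t) (z t) < 0"
      using acc_z_bounds(1)[OF sol, of t] mult_pos_pos[OF stiffness_pos(1), of "z t"] by linarith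
    then show "\<exists>y. (q has_real_derivative y) (at t) \<and> y < 0"
      using level_solutionD(5)[OF sol] by blast
  qed (use \<tau> level_solution_continuous(4)[OF sol] continuous_on_subset in \<open>auto simp: first_zero_def\<close>)
  then show ?thesis using q0 by simp
qed

text \<open>
  An earlier crossing would happen while \<open>cos (w * \<tau>)\<close> is still positive for the faster oscillator. The
  Wronskian is nondecreasing from \<open>0\<close> and equals \<open>q \<tau> * cos (w * \<tau>)\<close> at the crossing,
  which contradicts \<open>q \<tau> < 0\<close>. The bound keeps crossings away from the starting time, where the radial
  momentum vanishes.
\<close>

lemma crossing_time_lower_bound:
  assumes sol: "level_solution r z p q" and q0: "q 0 = 0" and \<tau>: "first_zero z \<tau>"
  shows "\<tau>_min \<le> \<tau>"
proof (rule ccontr)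
  assume "\<not> ?thesis"
  then have lt: "\<tau> < \<tau>_min" by simp
  have \<tau>0: "\<tau> > 0" "z \<tau> = 0" using \<tau> by (simp_all add: first_zero_def)
  define w where "w = sqrt stiffness_max"
  have w: "w > 0" "w^2 = stiffness_max" using stiffness_pos by (simp_all add: w_def)
  have w\<tau>: "w * \<tau>_min = pi / 2" using w by (simp add: \<tau>_min_def w_def[symmetric])
  have wt: "w * t < pi / 2" if "t \<le> \<tau>" for t
  proof -
    have "w * t < w * \<tau>_min" using that lt w by simp
    then show ?thesis by (simp add: w\<tau>)
  qed
  have "q \<tau> * cos (w * \<tau>) + w * z \<tau> * sin (w * \<tau>)
      \<ge> q 0 * cos (w * 0) + w * z 0 * sin (w * 0)"
  proof (rule DERIV_nonneg_imp_nondecreasing[where f = "\<lambda>t. q t * cos (w * t) + w * z t * sin (w * t)"])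
    fix t assume t: "0 \<le> t" "t \<le> \<tau>"
    have "cos (w * t) \<ge> 0"
      using mult_nonneg_nonneg[of w t] t w wt[OF t(2)] pi_gt_zero by (intro cos_ge_zero) linarith+
    moreover have "z t \<ge> 0"
      using \<tau> t by (cases "t = \<tau>") (auto simp: first_zero_def less_imp_le)
    then have "acc_z \<alpha> (r t) (z t) + w^2 * z t \<ge> 0"
      using acc_z_bounds(2)[OF sol, of t] w(2) by simp
    ultimately have "(acc_z \<alpha> (r t) (z t) + w^2 * z t) * cos (w * t) \<ge> 0"
      by simp
    then show "\<exists>y. ((\<lambda>t. q t * cos (w * t) + w * z t * sin (w * t)) has_real_derivative y) (at t) \<and> 0 \<le> y"
      using oscillator_comparison_derivative[OF sol] by blast
  qed (use \<tau>0 in simp)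
  then have "q \<tau> * cos (w * \<tau>) \<ge> 0" by (simp add: \<tau>0 q0)
  moreover have "cos (w * \<tau>) > 0"
    using wt[of \<tau>] mult_pos_pos[OF w(1) \<tau>0(1)] by (intro cos_gt_zero) auto
  ultimately show False
    using crossing_velocity_neg[OF assms] by (simp add: zero_le_mult_iff)
qed

text \<open>
  Since \<open>q \<tau> < 0\<close>, \<open>z\<close> is bounded below by a positive constant until shortly before \<open>\<tau>\<close> and negative
  at some time \<open>b\<close> shortly after. A uniformly close solution inherits both, so its first crossing
  falls into the short interval in between.
\<close>

lemma crossing_momentum_continuous:
  assumes sol: "level_solution r z p q" and q0: "q 0 = 0" and \<tau>: "first_zero z \<tau>" and "\<epsilon> > 0"
  obtains d where "d > 0" "\<And>r' z' p' q' \<tau>'. level_solution r' z' p' q' \<Longrightarrow> first_zero z' \<tau>' \<Longrightarrow>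
    dist (r' 0, z' 0, p' 0, q' 0) (r 0, z 0, p 0, q 0) < d \<Longrightarrow> \<bar>p' \<tau>' - p \<tau>\<bar> < \<epsilon>"
proof -
  obtain L where L: "L \<ge> 0" and dep: "\<And>r z p q r' z' p' q' t.
    level_solution r z p q \<Longrightarrow> level_solution r' z' p' q' \<Longrightarrow>
    dist (r t, z t, p t, q t) (r' t, z' t, p' t, q' t)
      \<le> exp (L * \<bar>t\<bar>) * dist (r 0, z 0, p 0, q 0) (r' 0, z' 0, p' 0, q' 0)"
    by (rule level_solution_dependence) blast
  have \<tau>0: "\<tau> > 0" "z \<tau> = 0" and before: "\<And>t. 0 \<le> t \<Longrightarrow> t < \<tau> \<Longrightarrow> 0 < z t"
    using \<tau> by (simp_all add: first_zero_def)
  obtain \<eta> where \<eta>: "\<eta> > 0" "\<And>t. \<bar>t - \<tau>\<bar> < \<eta> \<Longrightarrow> \<bar>p t - p \<tau>\<bar> < \<epsilon> / 2"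
  proof -
    have "isCont p \<tau>" using level_solutionD(4)[OF sol] DERIV_isCont by blast
    then have "\<exists>d>0. \<forall>t. dist t \<tau> < d \<longrightarrow> dist (p t) (p \<tau>) < \<epsilon> / 2"
      using \<open>\<epsilon> > 0\<close> unfolding continuous_at_eps_delta by (meson half_gt_zero)
    then show ?thesis using that by (auto simp: dist_real_def)
  qed
  define a where "a = \<tau> - min \<eta> \<tau> / 2"
  have a: "0 \<le> a" "a < \<tau>" "\<tau> - a < \<eta>" using \<eta>(1) \<tau>0(1) by (auto simp: a_def min_def)
  obtain b where b: "\<tau> < b" "b - \<tau> < \<eta>" "z b < 0"
  proof -
    obtain e where e: "e > 0" "\<And>s. 0 < s \<Longrightarrow> s < e \<Longrightarrow> z (\<tau> + s) < z \<tau>"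
      using has_real_derivative_neg_dec_right[OF level_solutionD(3)[OF sol, of \<tau>]
          crossing_velocity_neg[OF sol q0 \<tau>]] by auto
    show ?thesis
      using e(1) e(2)[of "min e \<eta> / 2"] \<eta>(1) \<tau>0(2)
      by (intro that[of "\<tau> + min e \<eta> / 2"]) (auto simp: min_def)
  qed
  obtain t0 where t0: "t0 \<in> {0..a}" "\<And>t. t \<in> {0..a} \<Longrightarrow> z t0 \<le> z t"
    using continuous_attains_inf[of "{0..a}" z] a level_solution_continuous(2)[OF sol]
      continuous_on_subset by (metis atLeastatMost_empty_iff2 compact_Icc not_less subset_UNIV)
  have m: "z t0 > 0" using before t0(1) a(2) by auto
  define \<delta> where "\<delta> = min (z t0) (min (- z b) (\<epsilon> / 2))"
  have \<delta>: "\<delta> > 0" using m b \<open>\<epsilon> > 0\<close> by (simp add: \<delta>_def)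
  show ?thesis
  proof (rule that[of "\<delta> / exp (L * b)"])
    show "\<delta> / exp (L * b) > 0" using \<delta> by simp
    fix r' z' p' q' \<tau>'
    assume sol': "level_solution r' z' p' q'" and \<tau>': "first_zero z' \<tau>'"
      and close: "dist (r' 0, z' 0, p' 0, q' 0) (r 0, z 0, p 0, q 0) < \<delta> / exp (L * b)"
    have near: "dist (r' t, z' t, p' t, q' t) (r t, z t, p t, q t) < \<delta>" if "0 \<le> t" "t \<le> b" for t
    proof -
      have "exp (L * \<bar>t\<bar>) \<le> exp (L * b)" using that L by (simp add: mult_left_mono)
      then have "exp (L * \<bar>t\<bar>) * dist (r' 0, z' 0, p' 0, q' 0) (r 0, z 0, p 0, q 0)
          \<le> exp (L * b) * dist (r' 0, z' 0, p' 0, q' 0) (r 0, z 0, p 0, q 0)"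
        by (intro mult_right_mono) auto
      also have "\<dots> < \<delta>" using close by (simp add: field_simps)
      finally show ?thesis using dep[OF sol' sol, of t] by linarith
    qed
    have nz: "\<bar>z' t - z t\<bar> < \<delta>" and np: "\<bar>p' t - p t\<bar> < \<delta>" if "0 \<le> t" "t \<le> b" for t
      using near[OF that] dist_components(2,3) order_le_less_trans by blast+
    have \<tau>'0: "\<tau>' > 0" "z' \<tau>' = 0" using \<tau>' by (simp_all add: first_zero_def)
    have "a < \<tau>'"
    proof (rule ccontr)
      assume "\<not> a < \<tau>'"
      then show False
        using nz[of \<tau>'] t0(2)[of \<tau>'] \<tau>'0 a b by (auto simp: \<delta>_def)
    qed
    moreover have "\<tau>' < b"
    proof (rule ccontr)
      assume "\<not> \<tau>' < b"
      then have "z' b \<ge> 0"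
        using \<tau>' \<tau>0 b by (cases "\<tau>' = b") (auto simp: first_zero_def less_imp_le)
      then show False
        using nz[of b] \<tau>0 b by (auto simp: \<delta>_def)
    qed
    ultimately have "\<bar>\<tau>' - \<tau>\<bar> < \<eta>" and "0 \<le> \<tau>'" "\<tau>' \<le> b" using a b \<tau>'0 by auto
    then have "\<bar>p \<tau>' - p \<tau>\<bar> < \<epsilon> / 2" "\<bar>p' \<tau>' - p \<tau>'\<bar> < \<epsilon> / 2"
      using \<eta>(2) np[of \<tau>'] by (auto simp: \<delta>_def)
    then show "\<bar>p' \<tau>' - p \<tau>\<bar> < \<epsilon>" by linarith
  qed
qed

end

section \<open>Comparison with the planar Kepler orbit\<close>

context isosceles_level
begin

lemma acc_r_planar:
  assumes "r > 0"
  shows "acc_r \<alpha> \<omega> r 0 = - (kepler_mass / r^3 * (r - semi_latus_rectum))"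
proof -
  have "acc_r \<alpha> \<omega> r 0 = \<omega>^2 / r^3 - kepler_mass / r^2"
    using assms by (simp add: acc_r_def kepler_mass_def power2_eq_square power3_eq_cube field_simps)
  also have "\<dots> = - (kepler_mass / r^3 * (r - semi_latus_rectum))"
    using assms kepler_mass_pos
    by (simp add: semi_latus_rectum_def power2_eq_square power3_eq_cube field_simps)
  finally show ?thesis .
qed

lemma planar_solution:
  assumes "level_solution R Z P Q" "Z 0 = 0" "Q 0 = 0"
  shows "Z t = 0"
  using level_solution_unique(2)[OF assms(1) level_solution_reflect[OF assms(1)], of t] assms(2,3)
  by simp

text \<open>
  The deviation \<open>R - l\<close> of a planar Kepler orbit from its semi-latus rectum \<open>l\<close> solves the linear
  equation \<open>y'' = - k / R^3 * y\<close>. Geometrically, by the focal equation of the conic, it is proportional to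
  the Cartesian coordinate of the body along the major axis. The factor \<open>\<sigma> = \<plusminus>1\<close> treats the starts at
  the apocentre and at the pericentre together.
\<close>

lemma kepler_deviation_derivatives:
  assumes K: "level_solution R Z P Q" "Z 0 = 0" "Q 0 = 0"
  shows "((\<lambda>t. \<sigma> * (R t - semi_latus_rectum)) has_real_derivative \<sigma> * P t) (at t)"
    "((\<lambda>t. \<sigma> * P t) has_real_derivative - (kepler_mass / (R t)^3 * (\<sigma> * (R t - semi_latus_rectum)))) (at t)"
  using level_solutionD(1,2,4)[OF K(1), of t] acc_r_planar[of "R t"] planar_solution[OF K, of t]
  by (auto intro!: derivative_eq_intros)

lemma kepler_momentum_decreasing:
  assumes K: "level_solution R Z P Q" "Z 0 = 0" "Q 0 = 0"
    and y: "\<And>t. a < t \<Longrightarrow> t < b \<Longrightarrow> 0 < \<sigma> * (R t - semi_latus_rectum)" and "a < b"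
  shows "\<sigma> * P b < \<sigma> * P a"
proof (rule DERIV_neg_imp_decreasing_open[where f = "\<lambda>t. \<sigma> * P t", OF \<open>a < b\<close>])
  fix t assume t: "a < t" "t < b"
  have "- (kepler_mass / (R t)^3 * (\<sigma> * (R t - semi_latus_rectum))) < 0"
    unfolding neg_less_0_iff_less using kepler_mass_pos level_solutionD(1)[OF K(1), of t]
    by (intro mult_pos_pos[OF _ y[OF t]] divide_pos_pos) auto
  then show "\<exists>y. ((\<lambda>t. \<sigma> * P t) has_real_derivative y) (at t) \<and> y < 0"
    using kepler_deviation_derivatives(2)[OF K] by blast
next
  show "continuous_on {a..b} (\<lambda>t. \<sigma> * P t)"
    by (intro continuous_intros continuous_on_subset[OF level_solution_continuous(3)[OF K(1)]]) simp
qed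

text \<open>
  Sturm comparison of \<open>z\<close> along a nearby orbit with \<open>y = \<sigma> * (R - l)\<close> along the planar orbit. The
  hypothesis \<open>fast\<close> says that the coefficient \<open>2 * (\<alpha> + 2) / \<rho>^3\<close> of \<open>z\<close> exceeds the
  coefficient \<open>k / R^3\<close> of \<open>y\<close>. The Wronskian \<open>W\<close> starts at \<open>0\<close> and is
  strictly decreasing while \<open>y\<close> and \<open>z\<close> are positive. If \<open>y\<close> vanished first, at time \<open>s\<close>, then
  \<open>W s = - z s * y' s\<close> would be nonnegative.
\<close>

lemma crossing_before_semi_latus_rectum:
  assumes K: "level_solution R Z P Q" "Z 0 = 0" "Q 0 = 0" "P 0 = 0"
    and y0: "0 < \<sigma> * (R 0 - semi_latus_rectum)"
    and sol: "level_solution r z p q" and q0: "q 0 = 0" and \<tau>: "first_zero z \<tau>"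
    and fast: "\<And>t. 0 \<le> t \<Longrightarrow> t \<le> \<tau> \<Longrightarrow>
      kepler_mass * sqrt ((r t)^2 + (\<alpha> + 2) / \<alpha> * (z t)^2)^3 < 2 * (\<alpha> + 2) * (R t)^3"
    and t: "0 \<le> t" "t \<le> \<tau>"
  shows "0 < \<sigma> * (R t - semi_latus_rectum)"
proof (rule ccontr)
  define y where "y t = \<sigma> * (R t - semi_latus_rectum)" for t
  assume "\<not> ?thesis"
  then have "y t \<le> 0" by (simp add: y_def)
  moreover have "continuous_on UNIV y"
    unfolding y_def by (intro continuous_intros level_solution_continuous(1)[OF K(1)])
  moreover have "y 0 > 0" using y0 by (simp add: y_def)
  ultimately obtain s where s: "first_zero y s" "s \<le> t"
    using first_zero_exists[of y t] t(1) by metis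
  then have s0: "0 < s" "y s = 0" "s \<le> \<tau>" and ypos: "\<And>u. 0 \<le> u \<Longrightarrow> u < s \<Longrightarrow> 0 < y u"
    using t by (auto simp: first_zero_def)
  have zpos: "\<And>u. 0 \<le> u \<Longrightarrow> u < s \<Longrightarrow> 0 < z u" and zs: "0 \<le> z s"
    using \<tau> s0 by (auto simp: first_zero_def) (metis less_eq_real_def)
  define W where "W t = y t * q t - z t * (\<sigma> * P t)" for t
  define W' where "W' t = y t * acc_z \<alpha> (r t) (z t) + z t * (kepler_mass / (R t)^3 * y t)" for t
  have W: "(W has_real_derivative W' t) (at t)" for t
    unfolding W_def W'_def y_def
    by (rule DERIV_cong[OF DERIV_diff[OF
            DERIV_mult[OF kepler_deviation_derivatives(1)[OF K(1-3)] level_solutionD(5)[OF sol]]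
            DERIV_mult[OF level_solutionD(3)[OF sol] kepler_deviation_derivatives(2)[OF K(1-3)]]]])
       (simp add: algebra_simps)
  have "W 0 > W s"
  proof (rule DERIV_neg_imp_decreasing_open[where f = W, OF s0(1)])
    fix u assume u: "0 < u" "u < s"
    define \<rho> where "\<rho> = sqrt ((r u)^2 + (\<alpha> + 2) / \<alpha> * (z u)^2)"
    have R: "R u > 0" and \<rho>: "\<rho> > 0"
      using level_solutionD(1)[OF K(1)] rho_pos[OF \<alpha>_pos level_solutionD(1)[OF sol, of u], of "z u"]
      by (simp_all add: \<rho>_def)
    have "kepler_mass * \<rho>^3 < 2 * (\<alpha> + 2) * (R u)^3"
      unfolding \<rho>_def using fast[of u] u s0(3) by simp
    then have "kepler_mass / (R u)^3 - 2 * (\<alpha> + 2) / \<rho>^3 < 0"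
      using R \<rho> by (simp add: field_simps)
    moreover have "W' u = y u * z u * (kepler_mass / (R u)^3 - 2 * (\<alpha> + 2) / \<rho>^3)"
      by (simp add: W'_def acc_z_def \<rho>_def algebra_simps)
    moreover have "y u * z u > 0" using ypos zpos u by simp
    ultimately have "W' u < 0" by (simp add: mult_pos_neg)
    then show "\<exists>d. (W has_real_derivative d) (at u) \<and> d < 0" using W by blast
  next
    show "continuous_on {0..s} W"
      using W by (meson DERIV_isCont continuous_at_imp_continuous_on)
  qed
  moreover have "W 0 = 0" by (simp add: W_def q0 K(4))
  moreover have "\<sigma> * P s < 0"
    using kepler_momentum_decreasing[OF K(1-3) _ s0(1), of \<sigma>] ypos K(4) by (auto simp: y_def)
  then have "W s \<ge> 0"
    using zs by (simp add: W_def s0(2) mult_nonneg_nonpos)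
  ultimately show False by simp
qed

text \<open>
  For orbits starting close enough to the turning point, the hypothesis of the comparison holds, so
  \<open>\<sigma> * P\<close> decreases along the planar orbit up to the crossing time. The crossing time is at least
  \<open>\<tau>_min\<close>, so \<open>\<sigma> * P\<close> is below the fixed negative number \<open>\<sigma> * P \<tau>_min\<close> at the crossing, and closeness
  transfers the sign to the nearby orbit.
\<close>

lemma crossing_momentum_sign_near_turning_point:
  assumes K: "level_solution R Z P Q" "Z 0 = 0" "Q 0 = 0" "P 0 = 0"
    and \<sigma>: "\<bar>\<sigma>\<bar> = 1" and y0: "0 < \<sigma> * (R 0 - semi_latus_rectum)"
  obtains d where "d > 0" "\<And>r z p q \<tau>. level_solution r z p q \<Longrightarrow> q 0 = 0 \<Longrightarrow> first_zero z \<tau> \<Longrightarrow> \<tau> \<le> \<tau>_max \<Longrightarrow>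
    dist (r 0, z 0, p 0, q 0) (R 0, 0, 0, 0) < d \<Longrightarrow> \<sigma> * p \<tau> < 0"
proof -
  obtain L where L: "L \<ge> 0" and dep: "\<And>r z p q r' z' p' q' t.
    level_solution r z p q \<Longrightarrow> level_solution r' z' p' q' \<Longrightarrow>
    dist (r t, z t, p t, q t) (r' t, z' t, p' t, q' t)
      \<le> exp (L * \<bar>t\<bar>) * dist (r 0, z 0, p 0, q 0) (r' 0, z' 0, p' 0, q' 0)"
    by (rule level_solution_dependence) blast
  define \<beta> where "\<beta> = (\<alpha> + 2) / \<alpha>"
  have \<beta>: "\<beta> > 0" using \<alpha>_pos by (simp add: \<beta>_def)
  define m where "m = root 3 (2 * (\<alpha> + 2) / kepler_mass)"
  have ratio: "2 * (\<alpha> + 2) / kepler_mass > 1"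
    using kepler_mass_pos by (simp add: kepler_mass_def)
  have m: "m > 1" "m^3 = 2 * (\<alpha> + 2) / kepler_mass"
    using ratio by (simp_all add: m_def odd_real_root_pow)
  \<comment> \<open>The default value 1 covers only the case that no nearby orbit exists: any such orbit forces \<open>\<sigma> * P \<tau>_min < 0\<close>.\<close>
  define \<eta> where "\<eta> = (if \<sigma> * P \<tau>_min < 0 then - (\<sigma> * P \<tau>_min) else 1)"
  define \<delta> where "\<delta> = min \<eta> ((m - 1) * r_min / (1 + sqrt \<beta>))"
  have s\<beta>: "1 + sqrt \<beta> > 0" using \<beta> by (simp add: add_pos_nonneg)
  have \<delta>: "\<delta> > 0"
    using m(1) turning_points_order(1) s\<beta> by (simp add: \<delta>_def \<eta>_def)
  show ?thesis
  proof (rule that[of "\<delta> / exp (L * \<tau>_max)"])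
    show "\<delta> / exp (L * \<tau>_max) > 0" using \<delta> by simp
    fix r z p q \<tau>
    assume sol: "level_solution r z p q" and q0: "q 0 = 0" and \<tau>: "first_zero z \<tau>"
      and \<tau>m: "\<tau> \<le> \<tau>_max"
      and close: "dist (r 0, z 0, p 0, q 0) (R 0, 0, 0, 0) < \<delta> / exp (L * \<tau>_max)"
    have \<tau>0: "\<tau> > 0" using \<tau> by (simp add: first_zero_def)
    have near: "dist (r t, z t, p t, q t) (R t, Z t, P t, Q t) < \<delta>" if "0 \<le> t" "t \<le> \<tau>" for t
    proof -
      have "exp (L * \<bar>t\<bar>) \<le> exp (L * \<tau>_max)" using that L \<tau>m by (simp add: mult_left_mono)
      then have "exp (L * \<bar>t\<bar>) * dist (r 0, z 0, p 0, q 0) (R 0, Z 0, P 0, Q 0)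
          \<le> exp (L * \<tau>_max) * dist (r 0, z 0, p 0, q 0) (R 0, Z 0, P 0, Q 0)"
        by (intro mult_right_mono) auto
      also have "\<dots> < \<delta>" using close by (simp add: field_simps K)
      finally show ?thesis using dep[OF sol K(1), of t] by linarith
    qed
    have fast: "kepler_mass * sqrt ((r t)^2 + (\<alpha> + 2) / \<alpha> * (z t)^2)^3 < 2 * (\<alpha> + 2) * (R t)^3"
      if t: "0 \<le> t" "t \<le> \<tau>" for t
    proof -
      define \<rho> where "\<rho> = sqrt ((r t)^2 + \<beta> * (z t)^2)"
      have nr: "\<bar>r t - R t\<bar> < \<delta>" and nz: "\<bar>z t - Z t\<bar> < \<delta>"
        by (rule order_le_less_trans[OF dist_components(1) near[OF t]],
            rule order_le_less_trans[OF dist_components(2) near[OF t]])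
      have R: "r_min \<le> R t" "R t > 0"
        using level_solution_bounds(1)[OF K(1)] level_solutionD(1)[OF K(1)] by blast+
      have Rsqrt: "sqrt ((R t)^2 + \<beta> * (Z t)^2) = R t"
        using planar_solution[OF K(1-3), of t] R(2) by simp
      have "\<rho> - R t \<le> \<bar>r t - R t\<bar> + sqrt \<beta> * \<bar>z t - Z t\<bar>"
        using rho_lipschitz[OF less_imp_le[OF \<beta>], of "r t" "z t" "R t" "Z t"]
        unfolding Rsqrt \<rho>_def[symmetric] by linarith
      also have "\<dots> < \<delta> + sqrt \<beta> * \<delta>"
        using nr nz \<beta> by (intro add_less_le_mono mult_left_mono) auto
      also have "\<dots> = \<delta> * (1 + sqrt \<beta>)" by (simp add: algebra_simps)
      also have "\<dots> \<le> (m - 1) * r_min / (1 + sqrt \<beta>) * (1 + sqrt \<beta>)"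
        using s\<beta> by (intro mult_right_mono) (auto simp: \<delta>_def)
      also have "\<dots> = (m - 1) * r_min" using s\<beta> by simp
      also have "\<dots> \<le> (m - 1) * R t" using m(1) R by (intro mult_left_mono) auto
      finally have "\<rho> < m * R t" by (simp add: algebra_simps)
      moreover have "\<rho> \<ge> 0"
        using \<beta> by (simp add: \<rho>_def)
      ultimately have "\<rho>^3 < (m * R t)^3"
        by (intro power_strict_mono) auto
      also have "\<dots> = 2 * (\<alpha> + 2) / kepler_mass * (R t)^3"
        by (simp add: power_mult_distrib m(2))
      finally show ?thesis
        using kepler_mass_pos by (simp add: \<rho>_def \<beta>_def field_simps)
    qed
    have ypos: "0 < \<sigma> * (R t - semi_latus_rectum)" if "0 \<le> t" "t \<le> \<tau>" for t
      using crossing_before_semi_latus_rectum[OF K y0 sol q0 \<tau> fast that] .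
    have \<tau>min: "\<tau>_min \<le> \<tau>" by (rule crossing_time_lower_bound[OF sol q0 \<tau>])
    have "\<sigma> * P \<tau>_min < \<sigma> * P 0"
      using \<tau>_bounds_pos(2) \<tau>min by (intro kepler_momentum_decreasing[OF K(1-3)] ypos) auto
    then have neg: "\<sigma> * P \<tau>_min < 0" using K(4) by simp
    have "\<sigma> * P \<tau> \<le> \<sigma> * P \<tau>_min"
    proof (cases "\<tau>_min = \<tau>")
      case False
      then have "\<sigma> * P \<tau> < \<sigma> * P \<tau>_min"
        using \<tau>min \<tau>_bounds_pos(2) by (intro kepler_momentum_decreasing[OF K(1-3)] ypos) auto
      then show ?thesis by simp
    qed simp
    moreover have "\<bar>p \<tau> - P \<tau>\<bar> < \<delta>"
      by (rule order_le_less_trans[OF dist_components(3) near]) (use \<tau>0 in simp_all)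
    then have "\<sigma> * (p \<tau> - P \<tau>) < \<delta>"
      using \<sigma> abs_ge_self[of "\<sigma> * (p \<tau> - P \<tau>)"] by (simp add: abs_mult)
    moreover have "\<delta> \<le> - (\<sigma> * P \<tau>_min)" using neg by (simp add: \<delta>_def \<eta>_def)
    ultimately show "\<sigma> * p \<tau> < 0" by (simp add: algebra_simps)
  qed
qed

text \<open>
  On the zero velocity curve \<open>2 * \<alpha> / \<rho>\<close> equals \<open>clearance r\<close>. Solving for \<open>z\<close> presents the upper half
  of the curve as the graph of \<open>brake_height\<close> over \<open>{r_min..r_max}\<close>, with height \<open>0\<close> at both ends.
\<close>

definition clearance :: "real \<Rightarrow> real" where
  "clearance s = \<omega>^2 / (2 * s^2) - 1 / (2 * s) - h"

definition brake_height :: "real \<Rightarrow> real" where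
  "brake_height s = sqrt (((2 * \<alpha> / clearance s)^2 - s^2) / ((\<alpha> + 2) / \<alpha>))"

lemma clearance_pos: "s > 0 \<Longrightarrow> clearance s > 0"
  using clearance_ge_gap[of s] gap_pos by (simp add: clearance_def)

lemma planar_potential_clearance: "s > 0 \<Longrightarrow> reduced_V \<alpha> \<omega> s 0 - h = clearance s - 2 * \<alpha> / s"
  by (simp add: reduced_V_def clearance_def)

lemma brake_height_on_level:
  assumes "r_min \<le> s" "s \<le> r_max"
  shows "reduced_V \<alpha> \<omega> s (brake_height s) = h"
proof -
  have s: "s > 0" using assms turning_points_order(1) by linarith
  note g = clearance_pos[OF s]
  have "clearance s \<le> 2 * \<alpha> / s"
    using planar_potential_le_iff[OF s] planar_potential_clearance[OF s] assms by simp
  then have "s \<le> 2 * \<alpha> / clearance s" using s g by (simp add: field_simps)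
  then have "s^2 \<le> (2 * \<alpha> / clearance s)^2" using s by (intro power_mono) auto
  then have "(\<alpha> + 2) / \<alpha> * (brake_height s)^2 = (2 * \<alpha> / clearance s)^2 - s^2"
    using \<alpha>_pos by (simp add: brake_height_def)
  then have "sqrt (s^2 + (\<alpha> + 2) / \<alpha> * (brake_height s)^2) = 2 * \<alpha> / clearance s"
    using g \<alpha>_pos by simp
  then show ?thesis
    using \<alpha>_pos g by (simp add: reduced_V_def clearance_def)
qed

lemma brake_height_pos:
  assumes "r_min < s" "s < r_max"
  shows "brake_height s > 0"
proof -
  have s: "s > 0" using assms turning_points_order(1) by linarith
  note g = clearance_pos[OF s]
  have "clearance s < 2 * \<alpha> / s"
    using planar_potential_less_iff[OF s] planar_potential_clearance[OF s] assms by simp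
  then have "s < 2 * \<alpha> / clearance s" using s g by (simp add: field_simps)
  then have "s^2 < (2 * \<alpha> / clearance s)^2" using s by (intro power_strict_mono) auto
  then show ?thesis using \<alpha>_pos by (simp add: brake_height_def)
qed

lemma brake_height_turning_point:
  assumes "s > 0" "reduced_V \<alpha> \<omega> s 0 = h"
  shows "brake_height s = 0"
proof -
  have "clearance s = 2 * \<alpha> / s" using planar_potential_clearance[OF assms(1)] assms(2) by simp
  then show ?thesis using assms(1) \<alpha>_pos by (simp add: brake_height_def)
qed

lemma brake_height_continuous: "continuous_on {r_min..r_max} brake_height"
proof -
  have "s > 0" if "s \<in> {r_min..r_max}" for s using that turning_points_order(1) by auto
  moreover from clearance_pos[OF this] have "clearance s \<noteq> 0" if "s \<in> {r_min..r_max}" for s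
    using that by force
  ultimately show ?thesis
    unfolding brake_height_def clearance_def using \<alpha>_pos
    by (intro continuous_intros) (auto simp: less_imp_neq[symmetric])
qed

text \<open>
  The shooting argument: the radial momentum at the first crossing is a continuous function of the
  starting point on the zero velocity curve, positive near one end and negative near the other.
\<close>

lemma symmetric_brake_solution_exists:
  obtains r z p q \<tau> where "level_solution r z p q" "p 0 = 0" "q 0 = 0" "first_zero z \<tau>" "p \<tau> = 0"
proof -
  let ?I = "{r_min<..<r_max}"
  have "\<exists>r z p q \<tau>. level_solution r z p q \<and> r 0 = s \<and> z 0 = brake_height s \<and> p 0 = 0 \<and> q 0 = 0 \<and>
      first_zero z \<tau> \<and> \<tau> \<le> \<tau>_max" if s: "s \<in> ?I" for s
  proof -
    obtain r z p q where *: "level_solution r z p q" "r 0 = s" "z 0 = brake_height s" "p 0 = 0" "q 0 = 0"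
    proof (rule brake_solution_exists[of s "brake_height s"])
      show "s > 0" "reduced_V \<alpha> \<omega> s (brake_height s) = h"
        using brake_height_on_level[of s] s turning_points_order(1) by auto
    qed
    then show ?thesis
      using crossing_exists[OF *(1)] brake_height_pos[of s] s by (metis greaterThanLessThan_iff)
  qed
  then have "\<forall>s. \<exists>r z p q \<tau>. s \<in> ?I \<longrightarrow> level_solution r z p q \<and> r 0 = s \<and> z 0 = brake_height s \<and>
      p 0 = 0 \<and> q 0 = 0 \<and> first_zero z \<tau> \<and> \<tau> \<le> \<tau>_max"
    by meson
  then obtain r z p q \<tau> where family: "\<forall>s. s \<in> ?I \<longrightarrow> level_solution (r s) (z s) (p s) (q s) \<and> r s 0 = s \<and>
      z s 0 = brake_height s \<and> p s 0 = 0 \<and> q s 0 = 0 \<and> first_zero (z s) (\<tau> s) \<and> \<tau> s \<le> \<tau>_max"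
    unfolding choice_iff by blast
  have sol: "level_solution (r s) (z s) (p s) (q s)"
    and init: "r s 0 = s" "z s 0 = brake_height s" "p s 0 = 0" "q s 0 = 0"
    and \<tau>: "first_zero (z s) (\<tau> s)" "\<tau> s \<le> \<tau>_max" if "s \<in> ?I" for s
    using family that by blast+
  define start where "start s = (s, brake_height s, 0 :: real, 0 :: real)" for s
  have start: "(r s 0, z s 0, p s 0, q s 0) = start s" if "s \<in> ?I" for s
    using init that by (simp add: start_def)
  have cont_start: "continuous_on {r_min..r_max} start"
    unfolding start_def by (intro continuous_intros brake_height_continuous)
  have "continuous_on ?I (\<lambda>s. p s (\<tau> s))"
    unfolding continuous_on_iff
  proof (intro ballI allI impI)
    fix s \<epsilon> :: real assume s: "s \<in> ?I" and \<epsilon>: "0 < \<epsilon>"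
    obtain d where d: "d > 0" "\<And>r' z' p' q' \<tau>'. level_solution r' z' p' q' \<Longrightarrow> first_zero z' \<tau>' \<Longrightarrow>
        dist (r' 0, z' 0, p' 0, q' 0) (r s 0, z s 0, p s 0, q s 0) < d \<Longrightarrow> \<bar>p' \<tau>' - p s (\<tau> s)\<bar> < \<epsilon>"
      using crossing_momentum_continuous[OF sol[OF s] init(4)[OF s] \<tau>(1)[OF s] \<epsilon>] by metis
    obtain e where e: "e > 0" "\<And>s'. s' \<in> {r_min..r_max} \<Longrightarrow> dist s' s < e \<Longrightarrow> dist (start s') (start s) < d"
      using cont_start d(1) s unfolding continuous_on_iff by (metis greaterThanLessThan_subseteq_atLeastAtMost_iff order_refl subsetD)
    show "\<exists>e>0. \<forall>s'\<in>?I. dist s' s < e \<longrightarrow> dist (p s' (\<tau> s')) (p s (\<tau> s)) < \<epsilon>"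
    proof (intro exI conjI ballI impI)
      fix s' assume s': "s' \<in> ?I" "dist s' s < e"
      then have "dist (start s') (start s) < d" using e(2) by auto
      then show "dist (p s' (\<tau> s')) (p s (\<tau> s)) < \<epsilon>"
        using d(2)[OF sol[OF s'(1)] \<tau>(1)[OF s'(1)]] start[OF s'(1)] start[OF s] by (simp add: dist_real_def)
    qed (rule e(1))
  qed
  then have conn: "connected ((\<lambda>s. p s (\<tau> s)) ` ?I)"
    by (intro connected_continuous_image) auto
  have I: "r_min < r_max" using turning_points_order by linarith
  have endpoint: "\<exists>s\<in>?I. \<sigma> * p s (\<tau> s) < 0"
    if e: "e \<in> {r_min, r_max}" and \<sigma>: "\<bar>\<sigma>\<bar> = 1" "0 < \<sigma> * (e - semi_latus_rectum)" for e \<sigma>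
  proof -
    have e0: "e > 0" "reduced_V \<alpha> \<omega> e 0 = h"
      using e turning_points_order(1) r_max_pos planar_potential_turning_points by auto
    obtain R Z P Q where K: "level_solution R Z P Q" "R 0 = e" "Z 0 = 0" "P 0 = 0" "Q 0 = 0"
      using brake_solution_exists[OF e0] by metis
    obtain d where d: "d > 0" "\<And>r z p q \<tau>. level_solution r z p q \<Longrightarrow> q 0 = 0 \<Longrightarrow> first_zero z \<tau> \<Longrightarrow> \<tau> \<le> \<tau>_max \<Longrightarrow>
        dist (r 0, z 0, p 0, q 0) (R 0, 0, 0, 0) < d \<Longrightarrow> \<sigma> * p \<tau> < 0"
      using crossing_momentum_sign_near_turning_point[OF K(1,3,5,4) \<sigma>(1)] \<sigma>(2) K(2) by metis
    have start_e: "start e = (R 0, 0, 0, 0)"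
      using brake_height_turning_point[OF e0] K(2) by (simp add: start_def)
    have "e \<in> {r_min..r_max}" using e I by auto
    then obtain c where c: "c > 0" "\<And>s. s \<in> {r_min..r_max} \<Longrightarrow> dist s e < c \<Longrightarrow> dist (start s) (start e) < d"
      using cont_start d(1) unfolding continuous_on_iff by metis
    have "e islimpt ?I" using e I by (auto simp: islimpt_greaterThanLessThan1 islimpt_greaterThanLessThan2)
    then obtain s where s: "s \<in> ?I" "dist s e < c"
      using c(1) unfolding islimpt_approachable by metis
    then have "dist (start s) (start e) < d" using c(2) by auto
    then have "\<sigma> * p s (\<tau> s) < 0"
      using d(2)[OF sol[OF s(1)] init(4)[OF s(1)] \<tau>[OF s(1)]] start[OF s(1)] start_e by simp
    then show ?thesis using s(1) by blast
  qed
  obtain s1 where s1: "s1 \<in> ?I" "p s1 (\<tau> s1) > 0"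
    using endpoint[of r_min "-1"] turning_points_order by auto
  obtain s2 where s2: "s2 \<in> ?I" "p s2 (\<tau> s2) < 0"
    using endpoint[of r_max 1] turning_points_order by auto
  have "0 \<in> (\<lambda>s. p s (\<tau> s)) ` ?I"
    using connectedD_interval[OF conn, of "p s2 (\<tau> s2)" "p s1 (\<tau> s1)" 0] s1 s2 by force
  then obtain s where "s \<in> ?I" "p s (\<tau> s) = 0" by force
  then show ?thesis
    using that[OF sol init(3,4) \<tau>(1)] by blast
qed

end

theorem theorem4p1:
  fixes \<omega> \<alpha> h :: real
  assumes "\<omega> > 0" and "\<alpha> > 0"
    and "h \<in> {- ((1 + 4 * \<alpha>)^2 / (8 * \<omega>^2)) <..< - (1 / (8 * \<omega>^2))}"
  shows "\<exists>r \<theta> z p\<^sub>r p\<^sub>\<theta> p\<^sub>z :: real \<Rightarrow> real.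
    (periodic_solution \<alpha> \<omega> r \<theta> z p\<^sub>r p\<^sub>\<theta> p\<^sub>z \<or> quasi_periodic_solution \<alpha> \<omega> r \<theta> z p\<^sub>r p\<^sub>\<theta> p\<^sub>z) \<and>
    has_energy \<alpha> h r \<theta> z p\<^sub>r p\<^sub>\<theta> p\<^sub>z \<and>
    has_angular_momentum \<omega> p\<^sub>\<theta> \<and>
    \<not> planar z"
proof -
  interpret isosceles_level \<alpha> \<omega> h
    by unfold_locales (use assms in auto)
  obtain r z p q \<tau> where sol: "level_solution r z p q" and brake: "p 0 = 0" "q 0 = 0"
    and \<tau>: "first_zero z \<tau>" "p \<tau> = 0"
    by (rule symmetric_brake_solution_exists)
  have red: "reduced_solution \<alpha> \<omega> r z p q" using sol by (simp add: level_solution_def)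
  obtain \<theta> where \<theta>: "isosceles_solution \<alpha> r \<theta> z p (\<lambda>_. \<omega>) q"
    by (rule isosceles_solution_lift[OF red])
  have \<tau>0: "\<tau> > 0" "z \<tau> = 0" "z 0 > 0" using \<tau>(1) by (simp_all add: first_zero_def)
  have "reduced_periodic_solution \<alpha> \<omega> (4 * \<tau>) r z p q"
    unfolding reduced_periodic_solution_def
    using red \<tau>0(1) symmetric_solution_periodic[OF sol brake \<tau>0(2) \<tau>(2)] by simp
  moreover have "has_angular_momentum \<omega> (\<lambda>_. \<omega>)"
    by (simp add: has_angular_momentum_def)
  moreover have "has_energy \<alpha> h r \<theta> z p (\<lambda>_. \<omega>) q"
    using level_solution_energy[OF sol] by (simp add: has_energy_def isosceles_H_eq_reduced_H)
  moreover have "\<not> planar z"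
    unfolding planar_def using \<tau>0(3) by (metis less_irrefl)
  ultimately show ?thesis
    using \<theta> periodic_or_quasi_periodic_iff by blast
qed

end
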